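(* Fix $f(t,z)=\sum_{i=0}^d a_i(t)z^i$ on $\Delta\times\mathbb{C}$ with $a_i$ holomorphic in $\Delta$, $a_d(0)\neq0$, $d\ge2$, and let $R>0$ be such that $|f(t,z)|\ge2|z|$ for all $t\in\Delta$, $|z|>R$; let $p(z)=f(0,z)$. Then there exists a constant $\lambda_1=\lambda_1(f)>0$ such that for every fixed $\lambda$ with $0<|\lambda|<\lambda_1$, letting $P(t,z)=(\lambda t,f(t,z))$, there are constants $k>0$ and $l>0$ such that for every point $z\in F(p)\cap\{|z|<R\}$, $$r(z)\ \ge\ k\, d(z,J(p))^l .$$ Furthermore, $l$ depends only on $p$.
   Context: Setting. $\Delta\subset\mathbb{C}$ is a disk centered at $0$; for $0<|\lambda|<1$, $P(t,z)=(\lambda t,f(t,z))$ maps $\Delta\times\mathbb{C}$ to itself. $J(p)$ and $F(p)$ are the Julia and Fatou sets of $p(z)=f(0,z)$ in the invariant fiber $\{t=0\}\cong\mathbb{C}$; $d(\cdot,\cdot)$ is Euclidean distance. $F(P)$ is the largest open subset of $\Delta\times\mathbb{C}$ on which $\{P^n\}_{n\ge 0}$ is a normal family (locally uniform divergence to infinity being allowed for limits). A horizontal holomorphic disk of size $\delta>0$ is a set $\{(t,z)\in\Delta\times\mathbb{C}: z=\phi(t),\ |t|<\delta\}$ with $\phi$ holomorphic in $\{|t|<\delta\}$. Definition of $r$. For $z\in F(p)$ with $|z|<R$, $r(z)$ is the supremum of all $r>0$ such that there exists a horizontal holomorphic disk of size $2r$ passing through the point $(0,z)$ (i.e. $\phi(0)=z$)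 and contained in $F(P)\cap\{|z|\le R\}$. *)

theory Defs
  imports "HOL-Complex_Analysis.Complex_Analysis"
begin

text \<open>
  Locally uniform convergence in the extended sense: near every point the sequence either
  converges uniformly or diverges uniformly to infinity. Which of the two occurs is constant on
  connected components of \<open>U\<close>, but may differ from one component to another.
\<close>

definition loc_unif_conv_ext ::
    "'a::topological_space set \<Rightarrow> (nat \<Rightarrow> 'a \<Rightarrow> 'b::real_normed_vector) \<Rightarrow> bool" where
  "loc_unif_conv_ext U g \<longleftrightarrow>
     (\<forall>x\<in>U. \<exists>V. open V \<and> x \<in> V \<and> V \<subseteq> U \<and>
        ((\<exists>h. uniform_limit V g h sequentially) \<or>
         (\<forall>B. \<forall>\<^sub>F n in sequentially. \<forall>y\<in>V. B < norm (g n y))))"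

definition normal_family_on ::
    "'a::topological_space set \<Rightarrow> ('a \<Rightarrow> 'b::real_normed_vector) set \<Rightarrow> bool" where
  "normal_family_on U \<F> \<longleftrightarrow>
     (\<forall>g::nat \<Rightarrow> 'a \<Rightarrow> 'b. range g \<subseteq> \<F> \<longrightarrow>
        (\<exists>s::nat \<Rightarrow> nat. strict_mono s \<and> loc_unif_conv_ext U (g \<circ> s)))"

text \<open>
  The largest open subset of \<open>X\<close> on which the iterates form a normal family. Since
  normality in the above sense is a local property (in second countable spaces), the union of all
  open sets of normality is one itself.
\<close>

definition fatou_set ::
    "'a::real_normed_vector set \<Rightarrow> ('a \<Rightarrow> 'a) \<Rightarrow> 'a set" where
  "fatou_set X g =
     \<Union>{U. open U \<and> U \<subseteq> X \<and> normal_family_on U (range (\<lambda>n. g ^^ n))}"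

definition julia_set ::
    "'a::real_normed_vector set \<Rightarrow> ('a \<Rightarrow> 'a) \<Rightarrow> 'a set" where
  "julia_set X g = X - fatou_set X g"

definition fiber_map ::
    "nat \<Rightarrow> (nat \<Rightarrow> complex \<Rightarrow> complex) \<Rightarrow> complex \<Rightarrow> complex \<Rightarrow> complex" where
  "fiber_map d a t z = (\<Sum>i\<le>d. a i t * z ^ i)"

definition skew_product ::
    "complex \<Rightarrow> (complex \<Rightarrow> complex \<Rightarrow> complex) \<Rightarrow> complex \<times> complex \<Rightarrow> complex \<times> complex" where
  "skew_product lam f = (\<lambda>(t, z). (lam * t, f t z))"

definition horizontal_disk ::
    "complex set \<Rightarrow> real \<Rightarrow> (complex \<times> complex) set \<Rightarrow> bool" where
  "horizontal_disk \<Delta> \<delta> D \<longleftrightarrow>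
     0 < \<delta> \<and>
     (\<exists>\<phi>. \<phi> holomorphic_on ball 0 \<delta> \<and>
          D = {(t, z). t \<in> \<Delta> \<and> z = \<phi> t \<and> norm t < \<delta>})"

text \<open>
  The supremum is taken in the extended reals: as \<open>\<delta>\<close> may exceed the radius of \<open>\<Delta>\<close>,
  it can be infinite. If no disk exists, it is minus infinity.
\<close>

definition disk_radius ::
    "complex set \<Rightarrow> (complex \<times> complex \<Rightarrow> complex \<times> complex) \<Rightarrow> real \<Rightarrow> complex \<Rightarrow> ereal" where
  "disk_radius \<Delta> P R z =
     Sup {ereal r | r. 0 < r \<and>
            (\<exists>D. horizontal_disk \<Delta> (2 * r) D \<and> (0, z) \<in> D \<and>
                 D \<subseteq> fatou_set (\<Delta> \<times> UNIV) P \<inter> {(t, w). norm w \<le> R})}"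

end

theory Submission
  imports Defs "HOL-Computational_Algebra.Computational_Algebra"
begin

text \<open>
  The disks can be taken constant: if \<open>ball z0 (2 * e)\<close> lies in the Fatou set of \<open>p\<close>, then
  \<open>(t, z0)\<close> lies in the Fatou set of \<open>P\<close> as soon as \<open>norm t < k * e ^ l\<close>. As the perturbation of
  \<open>p\<close> at time \<open>n\<close> has size at most \<open>B * norm lam ^ n * norm t\<close>, the fiber orbit of a point
  near \<open>z0\<close> is shadowed by true orbits of \<open>p\<close> starting in \<open>ball z0 e\<close>, provided that
  \<open>p ^^ n\<close> maps a ball of radius \<open>e\<close> onto a set that contains a ball of radius
  \<open>\<Theta> ^ n * e ^ l\<close>. Hence the point stays bounded if the Fatou component of \<open>z0\<close> is bounded,
  and escapes otherwise. No classification of Fatou components is needed.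

  The radius estimate follows from the distances of the orbit to the critical points, in the spirit of
  Denker, Przytycki and Urbanski: if a critical point \<open>c\<close> is not periodic, then, apart from one
  closest visit, the product of the distances of \<open>n\<close> orbit points to \<open>c\<close> is at least \<open>\<theta> ^ n\<close>.
  At the remaining exceptional times, at most one for each critical point, a disk of radius \<open>r\<close> still
  covers one of radius comparable to \<open>r ^ degree p\<close>, which leads to the exponent
  \<open>l = degree p ^ (degree p - 1)\<close>. Orbits that come close to a periodic critical point are trapped in
  a forward invariant set of all nearby fiber maps.
\<close>

subsection \<open>Preimages under polynomials\<close>

lemma complex_poly_eq_prod:
  obtains root where "q = smult (lead_coeff q) (\<Prod>i<degree q. [:- root i, 1:])"
    "\<And>z::complex. poly q z = lead_coeff q * (\<Prod>i<degree q. z - root i)"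
proof -
  obtain root where root: "smult (lead_coeff q) (\<Prod>i<degree q. [:-root i, 1:]) = q"
    using complex_poly_decompose' by blast
  have "poly q z = lead_coeff q * (\<Prod>i<degree q. z - root i)" for z
    by (subst root[symmetric]) (simp add: poly_prod)
  with root show ?thesis
    using that by metis
qed

lemma degree_minus_const: "degree (q - [:w:]) = degree (q :: complex poly)"
proof (cases "degree q = 0")
  case False
  then have "degree (q + [:- w:]) = degree q"
    by (intro degree_add_eq_left) simp
  moreover have "q + [:- w:] = q - [:w:]"
    by simp
  ultimately show ?thesis by (simp only:)
qed (auto elim!: degree_eq_zeroE)

lemma lead_coeff_minus_const:
  "0 < degree q \<Longrightarrow> coeff (q - [:w:]) (degree q) = lead_coeff (q :: complex poly)"
  by (simp add: coeff_pCons split: nat.split)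

text \<open>If all roots of \<open>q - [:w:]\<close> had distance at least \<open>e\<close> from
  \<open>x\<close>, the factorization into linear factors would contradict the bound on
  \<open>norm (w - poly q x)\<close>. No derivative is involved, so this version also serves near
  critical points.\<close>

lemma poly_eq_near_power:
  fixes q :: "complex poly"
  assumes "0 < e" "0 < degree q" "norm (w - poly q x) < norm (lead_coeff q) * e ^ degree q"
  shows "\<exists>y\<in>ball x e. poly q y = w"
proof (rule ccontr)
  assume no: "\<not> ?thesis"
  define Q where "Q = q - [:w:]"
  have Q: "degree Q = degree q" "coeff Q (degree q) = lead_coeff q"
    unfolding Q_def using assms(2) degree_minus_const lead_coeff_minus_const by auto
  obtain root where root: "\<And>z. poly Q z = lead_coeff Q * (\<Prod>i<degree Q. z - root i)"
    using complex_poly_eq_prod by metis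
  have "e \<le> norm (x - root i)" if "i < degree q" for i
  proof -
    have "poly Q (root i) = 0"
      using that by (auto simp: root Q)
    then have "poly q (root i) = w" by (simp add: Q_def)
    then show ?thesis using no by (force simp: dist_norm not_less)
  qed
  then have "e ^ degree q \<le> norm (\<Prod>i<degree q. x - root i)"
    using prod_mono[of "{..<degree q}" "\<lambda>_. e" "\<lambda>i. norm (x - root i)"] assms(1)
    by (simp add: prod_norm)
  then have "norm (lead_coeff q) * e ^ degree q \<le> norm (poly Q x)"
    by (simp add: root Q norm_mult mult_left_mono)
  then show False using assms(3) by (simp add: Q_def norm_minus_commute)
qed

text \<open>The logarithmic derivative of the product is the sum of the terms
  \<open>1 / (x - root i)\<close>, of norm at most \<open>n / e\<close>. Multiplied out, the bound
  needs no division and follows by induction from the product rule.\<close>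

lemma norm_pderiv_prod_le:
  fixes root :: "nat \<Rightarrow> complex"
  assumes "0 \<le> e" "\<And>i. i < n \<Longrightarrow> e \<le> norm (x - root i)"
  shows "e * norm (poly (pderiv (\<Prod>i<n. [:- root i, 1:])) x)
    \<le> real n * norm (\<Prod>i<n. x - root i)"
  using assms(2)
proof (induction n)
  case (Suc n)
  let ?Q = "\<Prod>i<n. [:- root i, 1:]"
  have Q: "poly ?Q x = (\<Prod>i<n. x - root i)"
    by (simp add: poly_prod)
  have IH: "e * norm (poly (pderiv ?Q) x) \<le> real n * norm (\<Prod>i<n. x - root i)"
    using Suc by simp
  have "poly (pderiv (\<Prod>i<Suc n. [:- root i, 1:])) x
      = poly ?Q x + (x - root n) * poly (pderiv ?Q) x"
    by (simp add: pderiv_mult pderiv_pCons algebra_simps del: mult_pCons_left mult_pCons_right)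
  then have "e * norm (poly (pderiv (\<Prod>i<Suc n. [:- root i, 1:])) x)
      \<le> e * (norm (poly ?Q x) + norm (x - root n) * norm (poly (pderiv ?Q) x))"
    using assms(1) norm_triangle_ineq[of "poly ?Q x" "(x - root n) * poly (pderiv ?Q) x"]
    by (simp add: mult_left_mono norm_mult)
  also have "\<dots> = e * norm (poly ?Q x) + norm (x - root n) * (e * norm (poly (pderiv ?Q) x))"
    by (simp add: algebra_simps)
  also have "\<dots> \<le> norm (x - root n) * norm (poly ?Q x)
      + norm (x - root n) * (real n * norm (\<Prod>i<n. x - root i))"
    by (intro add_mono mult_right_mono mult_left_mono IH) (use Suc.prems in auto)
  also have "\<dots> = real (Suc n) * norm (\<Prod>i<Suc n. x - root i)"
    by (simp add: Q norm_mult distrib_left distrib_right mult_ac)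
  finally show ?case .
qed simp

text \<open>
  If all roots of \<open>q - w\<close> have distance at least \<open>e\<close> from \<open>x\<close>, then the logarithmic derivative
  of \<open>q - w\<close> at \<open>x\<close> is at most \<open>degree q / e\<close>.
\<close>

lemma poly_eq_near_pderiv:
  fixes q :: "complex poly"
  assumes "0 < e" "0 < degree q" "degree q * norm (w - poly q x) < e * norm (poly (pderiv q) x)"
  shows "\<exists>y\<in>ball x e. poly q y = w"
proof (rule ccontr)
  assume no: "\<not> ?thesis"
  define Q where "Q = q - [:w:]"
  have Q: "degree Q = degree q" "coeff Q (degree q) = lead_coeff q"
    unfolding Q_def using assms(2) degree_minus_const lead_coeff_minus_const by auto
  obtain root where root: "Q = smult (lead_coeff Q) (\<Prod>i<degree Q. [:- root i, 1:])"
     "\<And>z. poly Q z = lead_coeff Q * (\<Prod>i<degree Q. z - root i)"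
    using complex_poly_eq_prod by metis
  have "e \<le> norm (x - root i)" if "i < degree q" for i
  proof -
    have "poly Q (root i) = 0"
      using that by (auto simp: root(2) Q)
    then have "poly q (root i) = w" by (simp add: Q_def)
    then show ?thesis using no by (force simp: dist_norm not_less)
  qed
  then have "e * norm (poly (pderiv (\<Prod>i<degree q. [:- root i, 1:])) x)
      \<le> real (degree q) * norm (\<Prod>i<degree q. x - root i)"
    using norm_pderiv_prod_le assms(1) by simp
  then have "norm (lead_coeff Q) * (e * norm (poly (pderiv (\<Prod>i<degree q. [:- root i, 1:])) x))
      \<le> norm (lead_coeff Q) * (real (degree q) * norm (\<Prod>i<degree q. x - root i))"
    by (rule mult_left_mono) simp
  then have "e * norm (poly (smult (lead_coeff Q) (pderiv (\<Prod>i<degree q. [:- root i, 1:]))) x)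
      \<le> real (degree q) * norm (poly Q x)"
    by (simp only: root(2) Q norm_mult poly_smult mult_ac)
  moreover have "pderiv Q = smult (lead_coeff Q) (pderiv (\<Prod>i<degree q. [:- root i, 1:]))"
    by (subst root(1)) (simp only: pderiv_smult Q)
  moreover have "pderiv Q = pderiv q"
    by (simp add: Q_def pderiv_diff pderiv_pCons)
  ultimately have "e * norm (poly (pderiv q) x) \<le> real (degree q) * norm (poly Q x)"
    by simp
  then show False using assms(3) by (simp add: Q_def norm_minus_commute)
qed

subsection \<open>Close returns to a critical point\<close>

text \<open>A ball about \<open>c\<close> that an iterate contracts into itself contains a fixed
  point \<open>x\<close> of that iterate, which attracts \<open>c\<close>; as \<open>c\<close> is
  not periodic, \<open>x\<close> differs from \<open>c\<close>. A second such ball of radius below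
  half of \<open>dist c x\<close> would hold the orbit of \<open>c\<close> near \<open>c\<close>,
  which is incompatible with the attraction to \<open>x\<close>.\<close>

lemma no_small_contracting_ball:
  fixes g :: "complex \<Rightarrow> complex"
  assumes nonper: "\<And>n. 0 < n \<Longrightarrow> (g ^^ n) c \<noteq> c"
  obtains \<delta>0 where "0 < \<delta>0"
    "\<And>\<delta> n. \<lbrakk>0 < \<delta>; \<delta> < \<delta>0; 0 < n; (g ^^ n) ` cball c \<delta> \<subseteq> cball c \<delta>;
       \<And>y y'. \<lbrakk>y \<in> cball c \<delta>; y' \<in> cball c \<delta>\<rbrakk>
         \<Longrightarrow> dist ((g ^^ n) y) ((g ^^ n) y') \<le> 1/2 * dist y y'\<rbrakk> \<Longrightarrow> False"
proof -
  define trap where "trap \<delta> n \<longleftrightarrow> 0 < \<delta> \<and> 0 < n \<and> (g ^^ n) ` cball c \<delta> \<subseteq> cball c \<delta> \<and>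
    (\<forall>y\<in>cball c \<delta>. \<forall>y'\<in>cball c \<delta>. dist ((g ^^ n) y) ((g ^^ n) y') \<le> 1/2 * dist y y')"
    for \<delta> n
  have "\<exists>\<delta>0>0. \<forall>\<delta> n. \<delta> < \<delta>0 \<longrightarrow> \<not> trap \<delta> n"
  proof (cases "\<exists>\<delta> n. trap \<delta> n")
    case False
    then show ?thesis by (intro exI[of _ 1]) auto
  next
    case True
    then obtain \<delta>1 n1 where t1: "trap \<delta>1 n1" by blast
    then have c1: "c \<in> cball c \<delta>1" and n1: "0 < n1" by (auto simp: trap_def)
    have "\<exists>!x\<in>cball c \<delta>1. (g ^^ n1) x = x"
      using t1 by (intro Banach_fix[of _ "1/2"]) (auto simp: trap_def complete_eq_closed)
    then obtain x where x: "x \<in> cball c \<delta>1" "(g ^^ n1) x = x" by blast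
    have "x \<noteq> c" using nonper[OF n1] x by auto
    have conv: "((g ^^ n1) ^^ k) c \<in> cball c \<delta>1 \<and>
        dist (((g ^^ n1) ^^ k) c) x \<le> (1/2)^k * dist c x" for k
    proof (induction k)
      case 0
      show ?case using c1 by simp
    next
      case (Suc k)
      let ?w = "((g ^^ n1) ^^ k) c"
      have "(g ^^ n1) ?w \<in> cball c \<delta>1"
        using Suc t1 unfolding trap_def by blast
      moreover have "dist ((g ^^ n1) ?w) ((g ^^ n1) x) \<le> 1/2 * dist ?w x"
        using Suc t1 x(1) unfolding trap_def by blast
      ultimately show ?case using Suc x by simp
    qed
    have "\<not> trap \<delta> n" if "\<delta> < dist c x / 2" for \<delta> n
    proof
      assume t: "trap \<delta> n"
      have inn: "((g ^^ n) ^^ k) c \<in> cball c \<delta>" for k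
      proof (induction k)
        case (Suc k)
        then have "(g ^^ n) (((g ^^ n) ^^ k) c) \<in> cball c \<delta>"
          using t unfolding trap_def by blast
        then show ?case by simp
      qed (use t in \<open>simp add: trap_def\<close>)
      \<comment> \<open>Time \<open>n1 * n\<close> is common to both maps: it is \<open>n\<close>
        steps of \<open>g ^^ n1\<close>, which bring \<open>c\<close> within half its distance to
        \<open>x\<close>, and \<open>n1\<close> steps of \<open>g ^^ n\<close>, which keep it close
        to \<open>c\<close>.\<close>
      have "dist ((g ^^ (n1 * n)) c) x \<le> (1/2)^n * dist c x"
        using conv[of n] by (simp add: funpow_mult mult.commute)
      also have "\<dots> \<le> (1/2)^1 * dist c x"
        using t by (intro mult_right_mono power_decreasing) (auto simp: trap_def Suc_le_eq)
      finally have "dist ((g ^^ (n1 * n)) c) x \<le> dist c x / 2" by simp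
      moreover have "dist c ((g ^^ (n1 * n)) c) < dist c x / 2"
        using inn[of n1] that by (simp add: funpow_mult mult.commute)
      ultimately show False
        using dist_triangle[of c x "(g ^^ (n1 * n)) c"] by linarith
    qed
    then show ?thesis
      using \<open>x \<noteq> c\<close> by (intro exI[of _ "dist c x / 2"]) auto
  qed
  then show ?thesis
    using that unfolding trap_def by metis
qed

text \<open>Abstracts the truncated distances of successive orbit points to one nonperiodic critical
  point. The block length \<open>k\<close> in \<open>return\<close> may be shorter than the return
  time \<open>n\<close>, so products have to be assembled from such blocks.\<close>

locale return_seq =
  fixes s :: "nat \<Rightarrow> real" and \<theta> :: real and m :: nat
  assumes \<theta>: "0 < \<theta>" "\<theta> \<le> 1"
    and s01: "0 \<le> s j" "s j \<le> 1"
    and zero_once: "\<lbrakk>i < j; j \<le> m; s i = 0\<rbrakk> \<Longrightarrow> s j \<noteq> 0"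
    and return: "\<lbrakk>0 < n; i + n \<le> m; 0 < \<delta>; \<delta> < \<theta>; s i \<le> \<delta>; s (i + n) \<le> \<delta>;
          \<And>j. \<lbrakk>i < j; j < i + n\<rbrakk> \<Longrightarrow> \<delta> \<le> s j\<rbrakk>
        \<Longrightarrow> \<exists>k>0. k \<le> n \<and> \<theta> ^ k \<le> \<delta> * prod s {i<..<i + k}"
begin

text \<open>Strong induction on the length, splitting at a smallest entry \<open>s i\<close> of
  \<open>{a..<b}\<close>. If it is below \<open>\<theta>\<close>, then \<open>b\<close> is a return
  to level \<open>s i\<close>, and \<open>return\<close> controls a block starting at
  \<open>i\<close>. The pieces before and after this block end at \<open>i\<close> and
  \<open>b\<close>, where \<open>s\<close> is again minimal, so the induction hypothesis applies to
  both.\<close>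

lemma prod_ge_before_min:
  "\<lbrakk>a \<le> b; b \<le> m; \<And>j. \<lbrakk>a \<le> j; j < b\<rbrakk> \<Longrightarrow> s b \<le> s j\<rbrakk> \<Longrightarrow> \<theta> ^ (b - a) \<le> prod s {a..<b}"
proof (induction "b - a" arbitrary: a b rule: less_induct)
  case less
  show ?case
  proof (cases "a = b")
    case False
    then have "a < b" using less.prems by simp
    define i where "i = (ARG_MIN s i. i \<in> {a..<b})"
    have i: "i \<in> {a..<b}" "\<And>j. j \<in> {a..<b} \<Longrightarrow> s i \<le> s j"
      using \<open>a < b\<close> arg_min_if_finite[of "{a..<b}" s] unfolding i_def arg_min_on_def
      by (auto simp: not_less)
    show ?thesis
    proof (cases "\<theta> \<le> s i")
      case True
      have "(\<Prod>j\<in>{a..<b}. \<theta>) \<le> prod s {a..<b}"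
        by (rule prod_mono) (use True i \<theta> in force)
      then show ?thesis by simp
    next
      case False
      have "s i \<noteq> 0"
        using less.prems(3)[of i] zero_once[of i b] s01(1)[of b] i less.prems(2) by auto
      then have "0 < s i" using s01(1)[of i] by simp
      have "\<exists>k>0. k \<le> b - i \<and> \<theta> ^ k \<le> s i * prod s {i<..<i + k}"
        by (rule return) (use i False less.prems \<open>0 < s i\<close> in auto)
      then obtain k where k: "0 < k" "k \<le> b - i" "\<theta> ^ k \<le> s i * prod s {i<..<i + k}"
        by blast
      have split: "{a..<b} = {a..<i} \<union> {i..<i+k} \<union> {i+k..<b}"
        using i(1) k by auto
      have "s i * prod s {i<..<i + k} = prod s {i..<i+k}"
        using k(1) by (simp add: prod.atLeast_Suc_lessThan atLeastSucLessThan_greaterThanLessThan)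
      then have 2: "\<theta> ^ k \<le> prod s {i..<i+k}" using k(3) by simp
      have 1: "\<theta> ^ (i - a) \<le> prod s {a..<i}"
        by (rule less.hyps) (use i less.prems in auto)
      have 3: "\<theta> ^ (b - (i+k)) \<le> prod s {i+k..<b}"
        by (rule less.hyps) (use i k less.prems in auto)
      have "\<theta> ^ (b - a) = \<theta> ^ (i - a) * \<theta> ^ k * \<theta> ^ (b - (i+k))"
        using i(1) k by (simp flip: power_add)
      also have "\<dots> \<le> prod s {a..<i} * prod s {i..<i+k} * prod s {i+k..<b}"
        using 1 2 3 \<theta> by (intro mult_mono mult_nonneg_nonneg prod_nonneg) (auto simp: s01)
      also have "\<dots> = prod s {a..<b}"
        unfolding split by (simp add: prod.union_disjoint ivl_disj_int Int_Un_distrib2)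
      finally show ?thesis .
    qed
  qed simp
qed

text \<open>Not the mirror image of \<open>prod_ge_before_min\<close>, since \<open>return\<close>
  controls a block at the beginning of a return, not at its end. Here \<open>i\<close> is a smallest
  entry of \<open>{a<..b}\<close> and the block starts at \<open>a\<close>. The factor
  \<open>\<delta> = s i\<close> supplies the entry at \<open>i\<close>,
  \<open>prod_ge_before_min\<close> fills the gap up to \<open>i\<close>, and the induction
  hypothesis covers the rest.\<close>

lemma prod_ge_after_min:
  "\<lbrakk>a \<le> b; b \<le> m; \<And>j. \<lbrakk>a < j; j \<le> b\<rbrakk> \<Longrightarrow> s a \<le> s j\<rbrakk> \<Longrightarrow> \<theta> ^ (b - a) \<le> prod s {a<..b}"
proof (induction "b - a" arbitrary: a b rule: less_induct)
  case less
  show ?case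
  proof (cases "a = b")
    case False
    then have "a < b" using less.prems by simp
    define i where "i = (ARG_MIN s i. i \<in> {a<..b})"
    have i: "i \<in> {a<..b}" "\<And>j. j \<in> {a<..b} \<Longrightarrow> s i \<le> s j"
      using \<open>a < b\<close> arg_min_if_finite[of "{a<..b}" s] unfolding i_def arg_min_on_def
      by (auto simp: not_less)
    show ?thesis
    proof (cases "\<theta> \<le> s i")
      case True
      have "(\<Prod>j\<in>{a<..b}. \<theta>) \<le> prod s {a<..b}"
        by (rule prod_mono) (use True i \<theta> in force)
      then show ?thesis by simp
    next
      case False
      have "s i \<noteq> 0"
        using less.prems(3)[of i] zero_once[of a i] s01(1)[of a] i less.prems(2) by auto
      then have "0 < s i" using s01(1)[of i] by simp
      have "\<exists>k>0. k \<le> i - a \<and> \<theta> ^ k \<le> s i * prod s {a<..<a + k}"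
        by (rule return) (use i False less.prems \<open>0 < s i\<close> in auto)
      then obtain k where k: "0 < k" "k \<le> i - a" "\<theta> ^ k \<le> s i * prod s {a<..<a + k}"
        by blast
      have split: "{a<..b} = {a<..<a+k} \<union> {a+k..<i} \<union> {i} \<union> {i<..b}"
        using i(1) k by auto
      have 1: "\<theta> ^ (i - (a+k)) \<le> prod s {a+k..<i}"
        by (rule prod_ge_before_min) (use i k less.prems in auto)
      have 2: "\<theta> ^ (b - i) \<le> prod s {i<..b}"
        by (rule less.hyps) (use i k less.prems in auto)
      have "\<theta> ^ (b - a) = \<theta> ^ k * \<theta> ^ (i - (a+k)) * \<theta> ^ (b - i)"
        using i(1) k by (simp flip: power_add)
      also have "\<dots> \<le> (s i * prod s {a<..<a+k}) * prod s {a+k..<i} * prod s {i<..b}"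
        using 1 2 k(3) \<theta> by (intro mult_mono mult_nonneg_nonneg prod_nonneg) (auto simp: s01)
      also have "\<dots> = prod s {a<..<a+k} * prod s {a+k..<i} * s i * prod s {i<..b}"
        by simp
      also have "\<dots> = prod s {a<..b}"
      proof -
        have "({a<..<a+k} \<union> {a+k..<i}) \<inter> {i} = {}"
          "({a<..<a+k} \<union> {a+k..<i} \<union> {i}) \<inter> {i<..b} = {}" "{a<..<a+k} \<inter> {a+k..<i} = {}"
          using i(1) k by auto
        then show ?thesis
          unfolding split by (simp only: prod.union_disjoint finite_Un finite_atLeastLessThan
            finite_greaterThanLessThan finite_greaterThanAtMost finite.intros) simp
      qed
      finally show ?thesis .
    qed
  qed simp
qed

lemma prod_ge_except_min:
  obtains i where "i \<le> m" "\<theta> ^ m \<le> prod s ({..m} - {i})"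
proof -
  define i where "i = (ARG_MIN s i. i \<in> {..m})"
  have i: "i \<in> {..m}" "\<And>j. j \<in> {..m} \<Longrightarrow> s i \<le> s j"
    using arg_min_if_finite[of "{..m}" s] unfolding i_def arg_min_on_def
    by (auto simp: not_less)
  have 1: "\<theta> ^ (i - 0) \<le> prod s {0..<i}"
    by (rule prod_ge_before_min) (use i in auto)
  have 2: "\<theta> ^ (m - i) \<le> prod s {i<..m}"
    by (rule prod_ge_after_min) (use i in auto)
  have "\<theta> ^ m = \<theta> ^ (i - 0) * \<theta> ^ (m - i)"
    using i(1) by (simp flip: power_add)
  also have "\<dots> \<le> prod s {0..<i} * prod s {i<..m}"
    using 1 2 \<theta> by (intro mult_mono prod_nonneg) (auto simp: s01)
  also have "\<dots> = prod s ({0..<i} \<union> {i<..m})"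
    by (subst prod.union_disjoint) auto
  also have "{0..<i} \<union> {i<..m} = {..m} - {i}"
    using i(1) by auto
  finally show ?thesis using i(1) that by auto
qed

end

section \<open>Critical points and derivative bounds of a polynomial with escape radius
  \<open>R\<close>\<close>

locale escape_poly =
  fixes q :: "complex poly" and R :: real
  assumes deg: "2 \<le> degree q" and R_pos: "0 < R"
    and esc: "R < norm z \<Longrightarrow> 2 * norm z \<le> norm (poly q z)"
begin

definition crit :: "complex set" where
  "crit = {c. poly (pderiv q) c = 0}"

lemma pderiv_nonzero: "pderiv q \<noteq> 0"
  using deg by (simp add: pderiv_eq_0_iff)

lemma finite_crit: "finite crit"
  unfolding crit_def using pderiv_nonzero by (rule poly_roots_finite)

lemma card_crit: "card crit \<le> degree q - 1"
  using card_poly_roots_bound[OF pderiv_nonzero] by (simp add: crit_def degree_pderiv)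

lemma orbit_escapes: "R < norm z \<Longrightarrow> 2 ^ n * norm z \<le> norm ((poly q ^^ n) z) \<and> R < norm ((poly q ^^ n) z)"
proof (induction n)
  case (Suc n)
  then show ?case using esc[of "(poly q ^^ n) z"] R_pos by simp
qed simp

lemma periodic_norm_le:
  assumes "0 < n" "(poly q ^^ n) c = c"
  shows "norm c \<le> R"
proof (rule ccontr)
  assume "\<not> ?thesis"
  then have c: "R < norm c" by simp
  have "2 ^ 1 * norm c \<le> 2 ^ n * norm c"
    using assms(1) by (intro mult_right_mono power_increasing) auto
  also have "\<dots> \<le> norm c"
    using orbit_escapes[OF c, of n] assms(2) by simp
  finally show False using c R_pos by simp
qed

text \<open>A linear factor splits off \<open>pderiv q\<close> at each critical point, and
  finiteness of \<open>crit\<close> allows a common constant. The margin 1 beyond \<open>R\<close>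
  leaves room for balls of radius at most 1 about orbit points.\<close>

lemma derivative_bound_exists:
  "\<exists>A\<ge>1. \<forall>y. norm y \<le> R + 1 \<longrightarrow> norm (poly (pderiv q) y) \<le> A \<and>
     (\<forall>c\<in>crit. norm (poly (pderiv q) y) \<le> A * norm (y - c))"
proof -
  have "\<exists>m>0. \<forall>y. norm y \<le> R + 1 \<longrightarrow> norm (poly (pderiv q) y) \<le> m * norm (y - c)"
    if "c \<in> crit" for c
  proof -
    have "[:- c, 1:] dvd pderiv q"
      using that by (simp add: crit_def poly_eq_0_iff_dvd)
    then obtain Q where Q: "pderiv q = [:- c, 1:] * Q"
      by (rule dvdE)
    obtain m where "m > 0" "\<forall>y. norm y \<le> R + 1 \<longrightarrow> norm (poly Q y) \<le> m"
      using poly_bound_exists by blast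
    moreover have "norm (poly (pderiv q) y) = norm (poly Q y) * norm (y - c)" for y
      by (simp only: Q poly_mult norm_mult) simp
    ultimately show ?thesis
      by (auto intro!: exI[of _ m] mult_right_mono)
  qed
  then obtain M where M: "\<And>c. c \<in> crit \<Longrightarrow> M c > 0"
    "\<And>c y. \<lbrakk>c \<in> crit; norm y \<le> R + 1\<rbrakk> \<Longrightarrow> norm (poly (pderiv q) y) \<le> M c * norm (y - c)"
    by metis
  obtain m where m: "m > 0" "\<And>y. norm y \<le> R + 1 \<Longrightarrow> norm (poly (pderiv q) y) \<le> m"
    using poly_bound_exists by blast
  define A where "A = 1 + m + sum M crit"
  have s: "0 \<le> sum M crit" by (intro sum_nonneg less_imp_le M)
  have "M c \<le> A" if "c \<in> crit" for c
  proof -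
    have "M c \<le> sum M crit"
      using that finite_crit by (intro member_le_sum less_imp_le M) auto
    then show ?thesis using m(1) by (simp add: A_def)
  qed
  then have "norm (poly (pderiv q) y) \<le> A * norm (y - c)" if "c \<in> crit" "norm y \<le> R + 1" for c y
    using M(2)[OF that] that(1) by (meson mult_right_mono norm_ge_zero order_trans)
  moreover have "norm (poly (pderiv q) y) \<le> A" if "norm y \<le> R + 1" for y
    using m(2)[OF that] s by (simp add: A_def)
  moreover have "1 \<le> A" using m s by (simp add: A_def)
  ultimately show ?thesis by blast
qed

definition A :: real where
  "A = (SOME A. A \<ge> 1 \<and> (\<forall>y. norm y \<le> R + 1 \<longrightarrow> norm (poly (pderiv q) y) \<le> A \<and>
     (\<forall>c\<in>crit. norm (poly (pderiv q) y) \<le> A * norm (y - c))))"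

lemma A:
  shows A_ge_1: "1 \<le> A"
    and A_bound: "norm y \<le> R + 1 \<Longrightarrow> norm (poly (pderiv q) y) \<le> A"
    and A_crit: "\<lbrakk>norm y \<le> R + 1; c \<in> crit\<rbrakk> \<Longrightarrow> norm (poly (pderiv q) y) \<le> A * norm (y - c)"
  using someI_ex[OF derivative_bound_exists, folded A_def] by blast+

lemma poly_lipschitz:
  assumes "convex S" "\<And>z. z \<in> S \<Longrightarrow> norm (poly (pderiv q) z) \<le> B" "x \<in> S" "y \<in> S"
  shows "norm (poly q x - poly q y) \<le> B * norm (x - y)"
  using field_differentiable_bound[OF assms(1) _ assms(2-4)]
  by (meson DERIV_subset poly_DERIV subset_UNIV)

text \<open>
  As long as the images of \<open>cball c (2 * \<delta>)\<close> are smaller than their distance to \<open>c\<close>, the derivative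
  of the iterate on this ball is bounded by the right-hand side. If this bound were small up to the
  time of the return, the ball would be contracted into itself.
\<close>

lemma return_estimate:
  assumes c: "c \<in> crit" and nonper: "\<And>n. 0 < n \<Longrightarrow> (poly q ^^ n) c \<noteq> c"
  obtains \<delta>0 where "0 < \<delta>0"
    "\<And>z n \<delta>. \<lbrakk>0 < \<delta>; \<delta> < \<delta>0; 0 < n; \<And>j. j < n \<Longrightarrow> norm ((poly q ^^ j) z) \<le> R;
       norm (z - c) \<le> \<delta>; norm ((poly q ^^ n) z - c) \<le> \<delta>;
       \<And>j. \<lbrakk>0 < j; j < n\<rbrakk> \<Longrightarrow> \<delta> \<le> norm ((poly q ^^ j) z - c)\<rbrakk>
      \<Longrightarrow> \<exists>k>0. k \<le> n \<and>
        1/6 < (2 * A) ^ k * \<delta> * (\<Prod>j\<in>{0<..<k}. min 1 (norm ((poly q ^^ j) z - c)))"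
proof -
  obtain \<delta>1 where \<delta>1: "0 < \<delta>1"
    "\<And>\<delta> n. \<lbrakk>0 < \<delta>; \<delta> < \<delta>1; 0 < n; (poly q ^^ n) ` cball c \<delta> \<subseteq> cball c \<delta>;
       \<And>y y'. \<lbrakk>y \<in> cball c \<delta>; y' \<in> cball c \<delta>\<rbrakk>
         \<Longrightarrow> dist ((poly q ^^ n) y) ((poly q ^^ n) y') \<le> 1/2 * dist y y'\<rbrakk> \<Longrightarrow> False"
    using no_small_contracting_ball[of "poly q" c] nonper by blast
  \<comment> \<open>Half of \<open>\<delta>1\<close>, as the ball to be contracted has radius
    \<open>2 * \<delta>\<close>. The bound 1/3 keeps this ball within distance 1 of
    \<open>z\<close>, where the estimates with \<open>A\<close> hold.\<close>
  define \<delta>0 where "\<delta>0 = min (\<delta>1 / 2) (1 / 3)"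
  show ?thesis
  proof (rule that[of \<delta>0])
    show "0 < \<delta>0" using \<delta>1(1) by (simp add: \<delta>0_def)
  next
    fix z n \<delta>
    assume \<delta>: "0 < \<delta>" "\<delta> < \<delta>0" and n: "0 < n"
      and bdd: "\<And>j. j < n \<Longrightarrow> norm ((poly q ^^ j) z) \<le> R"
      and start: "norm (z - c) \<le> \<delta>" and ret: "norm ((poly q ^^ n) z - c) \<le> \<delta>"
      and far: "\<And>j. \<lbrakk>0 < j; j < n\<rbrakk> \<Longrightarrow> \<delta> \<le> norm ((poly q ^^ j) z - c)"
    define orb where "orb j = (poly q ^^ j) z" for j
    define g where "g j = min 1 (norm (orb j - c))" for j
    \<comment> \<open>A Lipschitz constant of the \<open>k\<close>-th iterate on
      \<open>cball c (2 * \<delta>)\<close>, as long as the earlier values are at most 1/6: the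
      first step contributes \<open>2 * A * \<delta>\<close>, a later one at time \<open>j\<close>
      contributes \<open>2 * A * g j\<close>.\<close>
    define L where "L k = (2 * A) ^ k * \<delta> * prod g {0<..<k}" for k
    have \<delta>3: "\<delta> < 1 / 3" "2 * \<delta> < \<delta>1" using \<delta> by (auto simp: \<delta>0_def)
    have zc: "z \<in> cball c (2 * \<delta>)" using start \<delta> by (simp add: dist_norm norm_minus_commute)
    have nz: "norm z \<le> R" using bdd[of 0] n by simp
    have dz: "norm (y - z) \<le> 3 * \<delta>" if "y \<in> cball c (2 * \<delta>)" for y
    proof -
      have "norm (y - z) \<le> norm (y - c) + norm (c - z)"
        using norm_triangle_ineq[of "y - c" "c - z"] by simp
      then show ?thesis using that start by (simp add: dist_norm norm_minus_commute)
    qed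
    have "\<exists>k>0. k \<le> n \<and> 1/6 < L k"
    proof (rule ccontr)
      assume "\<not> ?thesis"
      then have small: "L k \<le> 1/6" if "0 < k" "k \<le> n" for k
        using that by (auto simp: not_less)
      have lip: "norm ((poly q ^^ Suc k) y - (poly q ^^ Suc k) y') \<le> L (Suc k) * norm (y - y')"
        if "Suc k \<le> n" "y \<in> cball c (2 * \<delta>)" "y' \<in> cball c (2 * \<delta>)" for k y y'
        using that
      proof (induction k arbitrary: y y')
        case 0
        have "norm (poly (pderiv q) w) \<le> L 1" if "w \<in> cball c (2 * \<delta>)" for w
        proof -
          have "norm w \<le> norm z + norm (w - z)"
            by (metis add.commute diff_add_cancel norm_triangle_ineq)
          then have "norm w \<le> R + 1"
            using dz[OF that] nz \<delta>3 by linarith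
          then have "norm (poly (pderiv q) w) \<le> A * norm (w - c)"
            using c by (rule A_crit)
          also have "\<dots> \<le> A * (2 * \<delta>)"
            using that A_ge_1 by (intro mult_left_mono) (auto simp: dist_norm norm_minus_commute)
          also have "\<dots> = L 1"
          proof -
            have "{0<..<1::nat} = {}" by auto
            then show ?thesis by (simp only: L_def prod.empty) simp
          qed
          finally show ?thesis .
        qed
        then have "norm (poly q y - poly q y') \<le> L 1 * norm (y - y')"
          by (rule poly_lipschitz[OF convex_cball]) (use 0 in auto)
        then show ?case by simp
      next
        case (Suc k)
        let ?k = "Suc k"
        have kn: "?k < n" using Suc.prems by simp
        have gk: "\<delta> \<le> g ?k" using far[of ?k] kn \<delta>3 by (simp add: g_def orb_def)
        \<comment> \<open>The factor 1/6 turns the distance \<open>3 * \<delta>\<close> from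
          \<open>z\<close> into \<open>\<delta> / 2\<close>, which is at most \<open>g ?k\<close>.
          On the ball of radius \<open>g ?k\<close> about the orbit point the derivative is at most
          \<open>2 * A * g ?k\<close>.\<close>
        have img: "(poly q ^^ ?k) w \<in> cball (orb ?k) (g ?k)" if "w \<in> cball c (2 * \<delta>)" for w
        proof -
          have "norm ((poly q ^^ ?k) w - orb ?k) \<le> L ?k * norm (w - z)"
            using Suc.IH[OF _ that zc] kn by (simp add: orb_def)
          also have "\<dots> \<le> 1/6 * (3 * \<delta>)"
            using small[of ?k] kn dz[OF that] by (intro mult_mono) auto
          also have "\<dots> \<le> g ?k" using gk \<delta> by simp
          finally show ?thesis by (simp add: dist_norm norm_minus_commute)
        qed
        have "norm (poly (pderiv q) w) \<le> 2 * A * g ?k" if "w \<in> cball (orb ?k) (g ?k)" for w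
        proof -
          have ow: "norm (w - orb ?k) \<le> g ?k"
            using that by (simp add: dist_norm norm_minus_commute)
          have "norm w \<le> norm (orb ?k) + norm (w - orb ?k)"
            by (metis add.commute diff_add_cancel norm_triangle_ineq)
          moreover have "g ?k \<le> 1" by (simp add: g_def)
          ultimately have w: "norm w \<le> R + 1"
            using bdd[of ?k] kn ow unfolding orb_def by linarith
          show ?thesis
          proof (cases "norm (orb ?k - c) \<le> 1")
            case True
            then have g: "g ?k = norm (orb ?k - c)" by (simp add: g_def)
            have "norm (w - c) \<le> norm (w - orb ?k) + norm (orb ?k - c)"
              using norm_triangle_ineq[of "w - orb ?k" "orb ?k - c"] by simp
            then have "norm (w - c) \<le> 2 * g ?k" using ow g by linarith
            then have "A * norm (w - c) \<le> A * (2 * g ?k)"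
              using A_ge_1 by (intro mult_left_mono) auto
            then show ?thesis using A_crit[OF w c] by simp
          next
            case False
            then show ?thesis using A_bound[OF w] A_ge_1 by (simp add: g_def)
          qed
        qed
        then have "norm (poly q ((poly q ^^ ?k) y) - poly q ((poly q ^^ ?k) y'))
            \<le> 2 * A * g ?k * norm ((poly q ^^ ?k) y - (poly q ^^ ?k) y')"
          using poly_lipschitz[OF convex_cball] img Suc.prems by blast
        also have "\<dots> \<le> 2 * A * g ?k * (L ?k * norm (y - y'))"
          using Suc.IH[of y y'] Suc.prems kn A_ge_1 gk \<delta> by (intro mult_left_mono) auto
        also have "2 * A * g ?k * (L ?k * norm (y - y')) = L (Suc ?k) * norm (y - y')"
        proof -
          have "{0<..<Suc ?k} = insert ?k {0<..<?k}" by auto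
          then have "prod g {0<..<Suc ?k} = g ?k * prod g {0<..<?k}" by simp
          then show ?thesis by (simp add: L_def)
        qed
        finally show ?case by simp
      qed
      obtain n' where n': "n = Suc n'" using n by (cases n) auto
      have lipn: "norm ((poly q ^^ n) y - (poly q ^^ n) y') \<le> 1/6 * norm (y - y')"
        if "y \<in> cball c (2 * \<delta>)" "y' \<in> cball c (2 * \<delta>)" for y y'
      proof -
        have "norm ((poly q ^^ n) y - (poly q ^^ n) y') \<le> L n * norm (y - y')"
          using lip[of n'] n' that by simp
        also have "\<dots> \<le> 1/6 * norm (y - y')"
          using small[of n] n by (intro mult_right_mono) auto
        finally show ?thesis .
      qed
      show False
      proof (rule \<delta>1(2)[of "2 * \<delta>" n])
        show "(poly q ^^ n) ` cball c (2 * \<delta>) \<subseteq> cball c (2 * \<delta>)"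
        proof clarify
          fix y assume y: "y \<in> cball c (2 * \<delta>)"
          have "norm ((poly q ^^ n) y - c) \<le> norm ((poly q ^^ n) y - (poly q ^^ n) z) + norm ((poly q ^^ n) z - c)"
            using norm_triangle_ineq[of "(poly q ^^ n) y - (poly q ^^ n) z" "(poly q ^^ n) z - c"] by simp
          \<comment> \<open>The orbit of \<open>z\<close> returns within \<open>\<delta>\<close> of
            \<open>c\<close>, and the contraction adds at most \<open>\<delta> / 2\<close>.\<close>
          also have "\<dots> \<le> 2 * \<delta>"
            using lipn[OF y zc] dz[OF y] ret \<delta>(1) by linarith
          finally show "(poly q ^^ n) y \<in> cball c (2 * \<delta>)"
            by (simp add: dist_norm norm_minus_commute)
        qed
      next
        fix y y' assume y: "y \<in> cball c (2 * \<delta>)" "y' \<in> cball c (2 * \<delta>)"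
        show "dist ((poly q ^^ n) y) ((poly q ^^ n) y') \<le> 1/2 * dist y y'"
          using lipn[OF y] norm_ge_zero[of "y - y'"] unfolding dist_norm by linarith
      qed (use \<delta> \<delta>3 n in auto)
    qed
    then show "\<exists>k>0. k \<le> n \<and>
        1/6 < (2 * A) ^ k * \<delta> * (\<Prod>j\<in>{0<..<k}. min 1 (norm ((poly q ^^ j) z - c)))"
      by (simp add: L_def g_def orb_def)
  qed
qed

end

subsection \<open>Images of balls under iterates\<close>

lemma prod_anti_mono:
  fixes f :: "'a \<Rightarrow> real"
  assumes "finite T" "S \<subseteq> T" "\<And>x. x \<in> T \<Longrightarrow> 0 \<le> f x" "\<And>x. x \<in> T \<Longrightarrow> f x \<le> 1"
  shows "prod f T \<le> prod f S"
proof -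
  have "prod f T = prod f (T - S) * prod f S"
    using assms(1,2) by (rule prod.subset_diff[rotated])
  also have "\<dots> \<le> 1 * prod f S"
    using assms by (intro mult_right_mono prod_le_1 prod_nonneg) auto
  finally show ?thesis by simp
qed

context escape_poly
begin

text \<open>Truncation at 1 allows factors to be dropped from a product of distances without
  decreasing it.\<close>

definition cdist :: "complex \<Rightarrow> complex \<Rightarrow> real" where
  "cdist c x = min 1 (norm (x - c))"

lemma cdist_bounds: "0 \<le> cdist c x" "cdist c x \<le> 1"
  by (auto simp: cdist_def)

lemma nonperiodic_crit_product:
  assumes c: "c \<in> crit" and nonper: "\<And>n. 0 < n \<Longrightarrow> (poly q ^^ n) c \<noteq> c"
  shows "\<exists>\<theta>. 0 < \<theta> \<and> \<theta> \<le> 1 \<and> (\<forall>z m. (\<forall>j\<le>m. norm ((poly q ^^ j) z) \<le> R) \<longrightarrow>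
    (\<exists>i\<le>m. \<theta> ^ m \<le> (\<Prod>j\<in>{..m} - {i}. cdist c ((poly q ^^ j) z))))"
proof -
  obtain \<delta>0 where \<delta>0: "0 < \<delta>0"
    "\<And>z n \<delta>. \<lbrakk>0 < \<delta>; \<delta> < \<delta>0; 0 < n; \<And>j. j < n \<Longrightarrow> norm ((poly q ^^ j) z) \<le> R;
       norm (z - c) \<le> \<delta>; norm ((poly q ^^ n) z - c) \<le> \<delta>;
       \<And>j. \<lbrakk>0 < j; j < n\<rbrakk> \<Longrightarrow> \<delta> \<le> norm ((poly q ^^ j) z - c)\<rbrakk>
      \<Longrightarrow> \<exists>k>0. k \<le> n \<and>
        1/6 < (2 * A) ^ k * \<delta> * (\<Prod>j\<in>{0<..<k}. min 1 (norm ((poly q ^^ j) z - c)))"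
    using return_estimate[OF c nonper] by blast
  \<comment> \<open>The factor \<open>1 / (2 * A)\<close> cancels the growth
    \<open>(2 * A) ^ k\<close> in \<open>return_estimate\<close>; the remaining
    \<open>(1/6) ^ k\<close> is at most 1/6 because \<open>k\<close> is positive.\<close>
  define \<theta> where "\<theta> = min \<delta>0 (1 / (12 * A))"
  have \<theta>: "0 < \<theta>" "\<theta> \<le> 1 / (12 * A)" "\<theta> \<le> \<delta>0" "\<theta> \<le> 1"
    using \<delta>0(1) A_ge_1 by (auto simp: \<theta>_def min_le_iff_disj field_simps)
  have "\<exists>i\<le>m. \<theta> ^ m \<le> (\<Prod>j\<in>{..m} - {i}. cdist c ((poly q ^^ j) z))"
    if bdd: "\<forall>j\<le>m. norm ((poly q ^^ j) z) \<le> R" for z m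
  proof -
    define s where "s j = cdist c ((poly q ^^ j) z)" for j
    interpret return_seq s \<theta> m
    proof
      show "0 \<le> s j" "s j \<le> 1" for j by (auto simp: s_def cdist_bounds)
    next
      fix i j assume ij: "i < j" "j \<le> m" "s i = 0"
      then have i: "(poly q ^^ i) z = c" by (auto simp: s_def cdist_def min_def split: if_splits)
      have "(poly q ^^ ((j - i) + i)) z = (poly q ^^ (j - i)) ((poly q ^^ i) z)"
        by (simp only: funpow_add o_apply)
      then have "(poly q ^^ j) z \<noteq> c" using nonper[of "j - i"] ij(1) i by simp
      then show "s j \<noteq> 0" by (auto simp: s_def cdist_def min_def)
    next
      fix n i :: nat and \<delta> :: real
      assume n: "0 < n" "i + n \<le> m" and \<delta>: "0 < \<delta>" "\<delta> < \<theta>" and si: "s i \<le> \<delta>" "s (i + n) \<le> \<delta>"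
        and far: "\<And>j. \<lbrakk>i < j; j < i + n\<rbrakk> \<Longrightarrow> \<delta> \<le> s j"
      define w where "w = (poly q ^^ i) z"
      have w: "(poly q ^^ j) w = (poly q ^^ (i + j)) z" for j
        by (simp add: w_def funpow_add add.commute[of i])
      have sw: "min 1 (norm ((poly q ^^ j) w - c)) = s (i + j)" for j
        by (simp add: w s_def cdist_def)
      have "\<exists>k>0. k \<le> n \<and>
        1/6 < (2 * A) ^ k * \<delta> * (\<Prod>j\<in>{0<..<k}. min 1 (norm ((poly q ^^ j) w - c)))"
      proof (rule \<delta>0(2))
        show "\<delta> < \<delta>0" using \<delta> \<theta> by simp
        show "norm ((poly q ^^ j) w) \<le> R" if "j < n" for j
          using that n bdd by (simp add: w)
        show "norm (w - c) \<le> \<delta>"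
          using sw[of 0] si(1) \<delta> \<theta> by (auto simp: min_def split: if_splits)
        show "norm ((poly q ^^ n) w - c) \<le> \<delta>"
          using sw[of n] si(2) \<delta> \<theta> by (auto simp: min_def split: if_splits)
        show "\<delta> \<le> norm ((poly q ^^ j) w - c)" if "0 < j" "j < n" for j
          using sw[of j] far[of "i + j"] that by (auto simp: min_def split: if_splits)
      qed (use n \<delta> in auto)
      then obtain k where k: "0 < k" "k \<le> n"
        "1/6 < (2 * A) ^ k * \<delta> * (\<Prod>j\<in>{0<..<k}. s (i + j))"
        unfolding sw by blast
      have re: "(\<Prod>j\<in>{0<..<k}. s (i + j)) = prod s {i<..<i + k}"
        by (rule prod.reindex_bij_witness[of _ "\<lambda>j. j - i" "\<lambda>j. i + j"]) auto
      have "\<theta> ^ k \<le> (1 / (12 * A)) ^ k"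
        using \<theta> by (intro power_mono) auto
      also have "\<dots> = (1/6) ^ k * (1 / (2 * A)) ^ k"
        by (simp flip: power_mult_distrib)
      also have "\<dots> \<le> (1/6) ^ 1 * (1 / (2 * A)) ^ k"
        using k(1) A_ge_1 by (intro mult_right_mono power_decreasing) auto
      also have "\<dots> \<le> (1 / (2 * A)) ^ k * ((2 * A) ^ k * \<delta> * prod s {i<..<i + k})"
      proof -
        have "0 \<le> (1 / (2 * A)) ^ k" using A_ge_1 by simp
        then show ?thesis
          using k(3) mult_left_mono[of "1/6" "(2 * A) ^ k * \<delta> * prod s {i<..<i + k}" "(1 / (2 * A)) ^ k"]
          by (simp add: re)
      qed
      also have "\<dots> = \<delta> * prod s {i<..<i + k}"
        using A_ge_1 by (simp add: power_one_over field_simps)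
      finally show "\<exists>k>0. k \<le> n \<and> \<theta> ^ k \<le> \<delta> * prod s {i<..<i + k}"
        using k by blast
    qed (use \<theta> in auto)
    show ?thesis using prod_ge_except_min unfolding s_def by metis
  qed
  then show ?thesis using \<theta> by blast
qed

text \<open>\<open>V\<close> shields the periodic critical points: orbits outside \<open>V\<close>
  keep a fixed distance from them. The nonperiodic ones are covered by
  \<open>nonperiodic_crit_product\<close>. The set \<open>E\<close> collects one exceptional time
  per critical point, and the constants multiply.\<close>

lemma crit_product:
  assumes V: "open V" "\<forall>c\<in>crit. \<forall>n>0. (poly q ^^ n) c = c \<longrightarrow> c \<in> V"
  shows "\<exists>\<theta>. 0 < \<theta> \<and> \<theta> \<le> 1 \<and>
    (\<forall>z m. (\<forall>j\<le>m. norm ((poly q ^^ j) z) \<le> R \<and> (poly q ^^ j) z \<notin> V) \<longrightarrow>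
      (\<exists>E\<subseteq>{..m}. card E \<le> degree q - 1 \<and>
        \<theta> ^ m \<le> (\<Prod>j\<in>{..m} - E. \<Prod>c\<in>crit. cdist c ((poly q ^^ j) z))))"
proof -
  have "\<exists>\<theta>. 0 < \<theta> \<and> \<theta> \<le> 1 \<and>
    (\<forall>z m. (\<forall>j\<le>m. norm ((poly q ^^ j) z) \<le> R \<and> (poly q ^^ j) z \<notin> V) \<longrightarrow>
    (\<exists>i\<le>m. \<theta> ^ m \<le> (\<Prod>j\<in>{..m} - {i}. cdist c ((poly q ^^ j) z))))" if c: "c \<in> crit" for c
  proof (cases "\<exists>n>0. (poly q ^^ n) c = c")
    case False
    then show ?thesis using nonperiodic_crit_product[OF c] by meson
  next
    case True
    then have "c \<in> V" using V(2) c by blast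
    then obtain \<delta> where \<delta>: "0 < \<delta>" "ball c \<delta> \<subseteq> V"
      using V(1) openE by blast
    \<comment> \<open>For a periodic critical point any index may be left out; leaving out
      \<open>m\<close> keeps exactly \<open>m\<close> factors, which matches the exponent.\<close>
    have "min 1 \<delta> ^ m \<le> (\<Prod>j\<in>{..m} - {m}. cdist c ((poly q ^^ j) z))"
      if out: "\<forall>j\<le>m. norm ((poly q ^^ j) z) \<le> R \<and> (poly q ^^ j) z \<notin> V" for z m
    proof -
      have "(\<Prod>j\<in>{..m} - {m}. min 1 \<delta>) \<le> (\<Prod>j\<in>{..m} - {m}. cdist c ((poly q ^^ j) z))"
      proof (rule prod_mono)
        fix j assume "j \<in> {..m} - {m}"
        then have "(poly q ^^ j) z \<notin> ball c \<delta>" using out \<delta> by auto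
        then have "\<delta> \<le> norm ((poly q ^^ j) z - c)"
          by (simp add: dist_norm norm_minus_commute not_less)
        then show "0 \<le> min 1 \<delta> \<and> min 1 \<delta> \<le> cdist c ((poly q ^^ j) z)"
          using \<delta> by (auto simp: cdist_def)
      qed
      then show ?thesis by simp
    qed
    then show ?thesis using \<delta> by (intro exI[of _ "min 1 \<delta>"]) auto
  qed
  then obtain \<theta> where \<theta>: "\<And>c. c \<in> crit \<Longrightarrow> 0 < \<theta> c \<and> \<theta> c \<le> 1"
    "\<And>c z m. \<lbrakk>c \<in> crit; \<And>j. j \<le> m \<Longrightarrow> norm ((poly q ^^ j) z) \<le> R \<and> (poly q ^^ j) z \<notin> V\<rbrakk> \<Longrightarrow>
    (\<exists>i\<le>m. \<theta> c ^ m \<le> (\<Prod>j\<in>{..m} - {i}. cdist c ((poly q ^^ j) z)))"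
    by metis
  have "\<exists>E\<subseteq>{..m}. card E \<le> degree q - 1 \<and>
        prod \<theta> crit ^ m \<le> (\<Prod>j\<in>{..m} - E. \<Prod>c\<in>crit. cdist c ((poly q ^^ j) z))"
    if "\<forall>j\<le>m. norm ((poly q ^^ j) z) \<le> R \<and> (poly q ^^ j) z \<notin> V" for z m
  proof -
    have "\<forall>c\<in>crit. \<exists>i. i \<le> m \<and> \<theta> c ^ m \<le> (\<Prod>j\<in>{..m} - {i}. cdist c ((poly q ^^ j) z))"
      using \<theta>(2)[of _ m z] that by simp
    from bchoice[OF this] obtain i where i: "\<And>c. c \<in> crit \<Longrightarrow> i c \<le> m"
      "\<And>c. c \<in> crit \<Longrightarrow> \<theta> c ^ m \<le> (\<Prod>j\<in>{..m} - {i c}. cdist c ((poly q ^^ j) z))"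
      by auto
    define E where "E = i ` crit"
    have "card E \<le> degree q - 1"
      using card_image_le[OF finite_crit, of i] card_crit by (simp add: E_def)
    moreover have "E \<subseteq> {..m}" using i(1) by (auto simp: E_def)
    moreover have "prod \<theta> crit ^ m \<le> (\<Prod>j\<in>{..m} - E. \<Prod>c\<in>crit. cdist c ((poly q ^^ j) z))"
    proof -
      have "prod \<theta> crit ^ m = (\<Prod>c\<in>crit. \<theta> c ^ m)" by (simp add: prod_power_distrib)
      also have "\<dots> \<le> (\<Prod>c\<in>crit. \<Prod>j\<in>{..m} - E. cdist c ((poly q ^^ j) z))"
      proof (rule prod_mono, intro conjI)
        fix c assume c: "c \<in> crit"
        show "0 \<le> \<theta> c ^ m" using \<theta>(1)[OF c] by simp
        have "(\<Prod>j\<in>{..m} - {i c}. cdist c ((poly q ^^ j) z))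
            \<le> (\<Prod>j\<in>{..m} - E. cdist c ((poly q ^^ j) z))"
          using c by (intro prod_anti_mono) (auto simp: E_def cdist_bounds)
        then show "\<theta> c ^ m \<le> (\<Prod>j\<in>{..m} - E. cdist c ((poly q ^^ j) z))"
          using i(2)[OF c] by simp
      qed
      also have "\<dots> = (\<Prod>j\<in>{..m} - E. \<Prod>c\<in>crit. cdist c ((poly q ^^ j) z))"
        by (rule prod.swap)
      finally show ?thesis .
    qed
    ultimately show ?thesis by blast
  qed
  moreover have "0 < prod \<theta> crit" using \<theta>(1) by (intro prod_pos) auto
  moreover have "prod \<theta> crit \<le> 1" using \<theta>(1) by (intro prod_le_1) (auto intro: less_imp_le)
  ultimately show ?thesis by blast
qed

text \<open>Every root of \<open>pderiv q\<close> is a critical point, so each of its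
  \<open>degree q - 1\<close> linear factors is at least the product of all truncated distances. The
  high power makes multiplicities irrelevant.\<close>

lemma pderiv_lower_bound:
  "\<exists>\<kappa>. 0 < \<kappa> \<and> \<kappa> \<le> 1 \<and>
     (\<forall>x. \<kappa> * (\<Prod>c\<in>crit. cdist c x) ^ (degree q - 1) \<le> norm (poly (pderiv q) x))"
proof -
  obtain root where root: "\<And>z. poly (pderiv q) z
      = lead_coeff (pderiv q) * (\<Prod>i<degree (pderiv q). z - root i)"
    using complex_poly_eq_prod by metis
  have lc: "0 < norm (lead_coeff (pderiv q))"
    using pderiv_nonzero by simp
  have "min 1 (norm (lead_coeff (pderiv q))) * (\<Prod>c\<in>crit. cdist c x) ^ (degree q - 1)
      \<le> norm (poly (pderiv q) x)" for x
  proof -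
    have "(\<Prod>i<degree q - 1. \<Prod>c\<in>crit. cdist c x) \<le> (\<Prod>i<degree q - 1. norm (x - root i))"
    proof (rule prod_mono, intro conjI)
      fix i assume "i \<in> {..<degree q - 1}"
      then have r: "root i \<in> crit"
        by (auto simp: crit_def root degree_pderiv)
      show "0 \<le> (\<Prod>c\<in>crit. cdist c x)" by (intro prod_nonneg) (simp add: cdist_bounds)
      have "(\<Prod>c\<in>crit. cdist c x) \<le> (\<Prod>c\<in>{root i}. cdist c x)"
        using r finite_crit by (intro prod_anti_mono) (auto simp: cdist_bounds)
      then show "(\<Prod>c\<in>crit. cdist c x) \<le> norm (x - root i)"
        by (auto simp: cdist_def)
    qed
    then have "min 1 (norm (lead_coeff (pderiv q))) * (\<Prod>c\<in>crit. cdist c x) ^ (degree q - 1)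
       \<le> norm (lead_coeff (pderiv q)) * (\<Prod>i<degree q - 1. norm (x - root i))"
      by (intro mult_mono) (auto intro!: zero_le_power prod_nonneg simp: cdist_bounds)
    then show ?thesis by (simp add: root norm_mult prod_norm degree_pderiv)
  qed
  then show ?thesis using lc by (intro exI[of _ "min 1 (norm (lead_coeff (pderiv q)))"]) auto
qed

text \<open>Image balls are followed along the orbit. At ordinary times
  \<open>poly_eq_near_pderiv\<close> costs a factor of the radius; at exceptional times
  \<open>poly_eq_near_power\<close> raises the radius to the power \<open>degree q\<close>. By
  \<open>crit_product\<close> the factors amount to one constant per step, and at most
  \<open>degree q - 1\<close> exceptional times produce the exponent of \<open>e\<close>.\<close>

lemma ball_subset_image:
  assumes V: "open V" "\<forall>c\<in>crit. \<forall>n>0. (poly q ^^ n) c = c \<longrightarrow> c \<in> V"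
  shows "\<exists>\<Theta>. 0 < \<Theta> \<and> \<Theta> \<le> 1 \<and>
    (\<forall>z m e. 0 < e \<and> e \<le> 1 \<and> (\<forall>j\<le>m. norm ((poly q ^^ j) z) \<le> R \<and> (poly q ^^ j) z \<notin> V) \<longrightarrow>
      ball ((poly q ^^ Suc m) z) (\<Theta> ^ Suc m * e ^ (degree q ^ (degree q - 1)))
        \<subseteq> (poly q ^^ Suc m) ` ball z e)"
proof -
  define D where "D = degree q"
  define N where "N = D - 1"
  have D: "2 \<le> D" "0 < D" using deg by (auto simp: D_def)
  obtain \<theta> where \<theta>: "0 < \<theta>" "\<theta> \<le> 1"
    "\<forall>z m. (\<forall>j\<le>m. norm ((poly q ^^ j) z) \<le> R \<and> (poly q ^^ j) z \<notin> V) \<longrightarrow>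
      (\<exists>E\<subseteq>{..m}. card E \<le> N \<and>
        \<theta> ^ m \<le> (\<Prod>j\<in>{..m} - E. \<Prod>c\<in>crit. cdist c ((poly q ^^ j) z)))"
    using crit_product[OF V, folded D_def, folded N_def] by (elim exE conjE)
  obtain \<kappa> where \<kappa>: "0 < \<kappa>" "\<kappa> \<le> 1"
    "\<And>x. \<kappa> * (\<Prod>c\<in>crit. cdist c x) ^ N \<le> norm (poly (pderiv q) x)"
    using pderiv_lower_bound[folded D_def, folded N_def] by (elim exE conjE) simp
  \<comment> \<open>One constant for both kinds of steps: \<open>\<kappa> / D\<close> is for
    \<open>poly_eq_near_pderiv\<close>, the leading coefficient for
    \<open>poly_eq_near_power\<close>.\<close>
  define c1 where "c1 = min (\<kappa> / D) (norm (lead_coeff q))"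
  have "\<kappa> / D \<le> 1" using \<kappa> D by (simp add: field_simps)
  moreover have "c1 \<le> \<kappa> / D" "c1 \<le> norm (lead_coeff q)" by (simp_all add: c1_def)
  moreover have "0 < norm (lead_coeff q)" using deg by auto
  then have "0 < c1" using \<kappa>(1) D(2) by (simp add: c1_def)
  ultimately have c1: "0 < c1" "c1 \<le> 1" "c1 \<le> \<kappa> / D" "c1 \<le> norm (lead_coeff q)"
    by linarith+
  define \<Theta> where "\<Theta> = (c1 * \<theta> ^ N) ^ (D ^ N)"
  have c\<theta>: "0 < c1 * \<theta> ^ N" "c1 * \<theta> ^ N \<le> 1"
    using c1 \<theta> by (auto intro!: mult_le_one power_le_one)
  have "ball ((poly q ^^ Suc m) z) (\<Theta> ^ Suc m * e ^ (D ^ N)) \<subseteq> (poly q ^^ Suc m) ` ball z e"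
    if e: "0 < e" "e \<le> 1"
      and orb: "\<forall>j\<le>m. norm ((poly q ^^ j) z) \<le> R \<and> (poly q ^^ j) z \<notin> V" for z m e
  proof -
    obtain E where E: "E \<subseteq> {..m}" "card E \<le> N"
      "\<theta> ^ m \<le> (\<Prod>j\<in>{..m} - E. \<Prod>c\<in>crit. cdist c ((poly q ^^ j) z))"
      using \<theta>(3)[THEN spec, THEN spec, THEN mp, OF orb] by (elim exE conjE)
    have finE: "finite E" using E(1) by (rule finite_subset) simp
    define G where "G j = (\<Prod>c\<in>crit. cdist c ((poly q ^^ j) z))" for j
    have G: "0 \<le> G j" "G j \<le> 1" for j
      by (auto simp: G_def cdist_bounds intro!: prod_nonneg prod_le_1)
    \<comment> \<open>The radius after \<open>k\<close> steps is \<open>b k ^ M k\<close>: the base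
      collects the factors lost, and the exponent \<open>M k\<close> gains a factor \<open>D\<close>
      at each exceptional time.\<close>
    define b where "b k = e * c1 ^ k * (\<Prod>j\<in>{..<k} - E. G j ^ N)" for k
    have b: "0 \<le> b k" "b k \<le> 1" for k
      using e c1 G by (auto simp: b_def intro!: mult_nonneg_nonneg prod_nonneg mult_le_one power_le_one prod_le_1)
    define M where "M k = D ^ card (E \<inter> {..<k})" for k
    have M: "1 \<le> M k" for k using D by (simp add: M_def)
    have pow_le: "x ^ M k \<le> x" if "0 \<le> x" "x \<le> 1" for x :: real and k
      using power_decreasing[of 1 "M k" x] that M by simp
    have "ball ((poly q ^^ k) z) (b k ^ M k) \<subseteq> (poly q ^^ k) ` ball z e" for k
    proof (induction k)
      case 0
      then show ?case by (auto simp: b_def M_def)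
    next
      case (Suc k)
      let ?x = "(poly q ^^ k) z"
      show ?case
      proof
        fix w assume "w \<in> ball ((poly q ^^ Suc k) z) (b (Suc k) ^ M (Suc k))"
        then have w: "norm (w - poly q ?x) < b (Suc k) ^ M (Suc k)"
          by (simp add: dist_norm norm_minus_commute)
        have "\<exists>y\<in>ball ?x (b k ^ M k). poly q y = w"
        proof (cases "k \<in> E")
          case False
          then have "{..<Suc k} - E = insert k ({..<k} - E)" by auto
          then have bS: "b (Suc k) = c1 * G k ^ N * b k" by (simp add: b_def)
          have "E \<inter> {..<Suc k} = E \<inter> {..<k}" using False by (auto simp: less_Suc_eq)
          then have MS: "M (Suc k) = M k" by (simp add: M_def)
          \<comment> \<open>If \<open>G k\<close> vanishes, the new ball is empty and there is
            nothing to show; the point \<open>w\<close> excludes this.\<close>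
          have "0 < b (Suc k) ^ M (Suc k)" using w by (meson norm_ge_zero order_le_less_trans)
          then have "b k \<noteq> 0" using M[of "Suc k"] by (auto simp: bS power_0_left split: if_splits)
          then have bk: "0 < b k" using b(1)[of k] by simp
          have "b (Suc k) ^ M (Suc k) = (c1 * G k ^ N) ^ M k * b k ^ M k"
            by (simp add: bS MS power_mult_distrib)
          also have "\<dots> \<le> (c1 * G k ^ N) * b k ^ M k"
            using c1 G[of k] bk
            by (intro mult_right_mono pow_le) (auto intro!: mult_le_one power_le_one)
          also have "\<dots> \<le> (\<kappa> / D * G k ^ N) * b k ^ M k"
            using c1 G[of k] bk by (intro mult_right_mono) auto
          finally have "norm (w - poly q ?x) < (\<kappa> / D * G k ^ N) * b k ^ M k"
            using w by linarith
          then have "D * norm (w - poly q ?x) < (\<kappa> * G k ^ N) * b k ^ M k"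
            using D by (simp add: field_simps)
          also have "\<dots> \<le> norm (poly (pderiv q) ?x) * b k ^ M k"
            using \<kappa>(3)[of ?x] bk by (intro mult_right_mono) (auto simp: G_def)
          finally show ?thesis
            using bk D by (intro poly_eq_near_pderiv) (auto simp: D_def mult.commute)
        next
          case True
          then have "{..<Suc k} - E = {..<k} - E" by (auto simp: less_Suc_eq)
          then have bS: "b (Suc k) = c1 * b k" by (simp add: b_def)
          have "E \<inter> {..<Suc k} = insert k (E \<inter> {..<k})" using True by auto
          then have MS: "M (Suc k) = M k * D" using finE by (simp add: M_def)
          have "0 < b (Suc k) ^ M (Suc k)" using w by (meson norm_ge_zero order_le_less_trans)
          then have "b k \<noteq> 0" using M[of "Suc k"] by (auto simp: bS power_0_left split: if_splits)
          then have bk: "0 < b k" using b(1)[of k] by simp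
          have "b (Suc k) ^ M (Suc k) = c1 ^ M (Suc k) * (b k ^ M k) ^ D"
            by (simp add: bS MS power_mult_distrib power_mult)
          also have "\<dots> \<le> c1 * (b k ^ M k) ^ D"
            using c1 bk by (intro mult_right_mono pow_le) auto
          also have "\<dots> \<le> norm (lead_coeff q) * (b k ^ M k) ^ D"
            using c1 bk by (intro mult_right_mono) auto
          finally show ?thesis
            using w bk D by (intro poly_eq_near_power) (auto simp: D_def)
        qed
        then show "w \<in> (poly q ^^ Suc k) ` ball z e"
          using Suc.IH by (auto simp: image_iff subset_iff)
      qed
    qed
    then have ball: "ball ((poly q ^^ Suc m) z) (b (Suc m) ^ M (Suc m)) \<subseteq> (poly q ^^ Suc m) ` ball z e" .
    \<comment> \<open>Weakening the exponent from \<open>m\<close> to \<open>Suc m\<close> lets all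
      constants appear to the same power.\<close>
    have "\<theta> ^ (N * Suc m) \<le> \<theta> ^ (N * m)"
      using \<theta> by (intro power_decreasing) auto
    also have "\<dots> = (\<theta> ^ m) ^ N" by (simp add: power_mult mult.commute flip: power_mult)
    also have "\<dots> \<le> (\<Prod>j\<in>{..m} - E. G j) ^ N"
      using E(3) \<theta> by (intro power_mono) (auto simp: G_def)
    also have "\<dots> = (\<Prod>j\<in>{..<Suc m} - E. G j ^ N)"
      by (simp add: prod_power_distrib lessThan_Suc_atMost)
    finally have "e * c1 ^ Suc m * \<theta> ^ (N * Suc m) \<le> b (Suc m)"
      unfolding b_def using e c1 by (intro mult_left_mono) auto
    then have "e * (c1 * \<theta> ^ N) ^ Suc m \<le> b (Suc m)"
      by (simp only: power_mult_distrib power_mult mult_ac)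
    moreover have "0 \<le> e * (c1 * \<theta> ^ N) ^ Suc m" using e c\<theta> by (intro mult_nonneg_nonneg) auto
    ultimately have "(e * (c1 * \<theta> ^ N) ^ Suc m) ^ (D ^ N) \<le> b (Suc m) ^ (D ^ N)"
      by (intro power_mono)
    moreover have "(e * (c1 * \<theta> ^ N) ^ Suc m) ^ (D ^ N) = \<Theta> ^ Suc m * e ^ (D ^ N)"
      by (simp only: \<Theta>_def power_mult_distrib mult_ac flip: power_mult)
    \<comment> \<open>Since \<open>b (Suc m)\<close> is at most 1, the worst exponent is the one for
      \<open>N\<close> exceptional times.\<close>
    moreover have "b (Suc m) ^ (D ^ N) \<le> b (Suc m) ^ M (Suc m)"
    proof (rule power_decreasing)
      have "card (E \<inter> {..<Suc m}) \<le> N"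
        using E(2) card_mono[OF finE, of "E \<inter> {..<Suc m}"] by simp
      then show "M (Suc m) \<le> D ^ N" unfolding M_def using D by (intro power_increasing) auto
    qed (use b in auto)
    ultimately have "\<Theta> ^ Suc m * e ^ (D ^ N) \<le> b (Suc m) ^ M (Suc m)" by simp
    then show ?thesis using ball by (meson order_trans subset_ball)
  qed
  moreover have "0 < \<Theta>" "\<Theta> \<le> 1"
    using c\<theta> by (auto simp: \<Theta>_def intro!: power_le_one)
  ultimately show ?thesis
    unfolding D_def[symmetric] N_def[symmetric] by (intro exI[of _ \<Theta>]) simp
qed

end

subsection \<open>Shadowing of fiber orbits\<close>

locale skew_family = escape_poly +
  fixes f :: "complex \<Rightarrow> complex \<Rightarrow> complex" and \<rho> B :: real
  assumes \<rho>_pos: "0 < \<rho>" and B_pos: "0 < B"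
    and f_zero: "f 0 = poly q"
    and f_esc: "\<lbrakk>norm t < \<rho>; R < norm z\<rbrakk> \<Longrightarrow> 2 * norm z \<le> norm (f t z)"
    and f_pert: "\<lbrakk>norm t \<le> \<rho> / 2; norm z \<le> R + 1\<rbrakk> \<Longrightarrow> norm (f t z - poly q z) \<le> B * norm t"
begin

text \<open>
  The radii grow by the factor \<open>2 * A\<close> along the cycle; the loss is recovered at \<open>c\<close>, near which
  \<open>poly q\<close> contracts quadratically.
\<close>

lemma superattracting_trap:
  assumes c: "c \<in> crit" and n: "0 < n" and per: "(poly q ^^ n) c = c"
  shows "\<exists>V \<tau>. open V \<and> bounded V \<and> c \<in> V \<and> 0 < \<tau> \<and> (\<forall>s w. norm s < \<tau> \<longrightarrow> w \<in> V \<longrightarrow> f s w \<in> V)"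
proof -
  define x where "x i = (poly q ^^ i) c" for i
  define a where "a = 2 * A"
  \<comment> \<open>Chosen so that the last radius \<open>r n = 1 / a ^ n\<close> has square
    \<open>\<eta>\<close>. The ball about \<open>c\<close> is then mapped into one of radius
    \<open>A * \<eta>\<close>, and a perturbation of size \<open>\<eta>\<close> still fits into
    \<open>r 1 = 2 * A * \<eta>\<close>.\<close>
  define \<eta> where "\<eta> = 1 / a ^ (2 * n)"
  define r where "r i = \<eta> * a ^ i" for i
  \<comment> \<open>The indices run from 1 to \<open>n\<close>, so that \<open>c = x n\<close> is
    the centre of the last and largest ball and the cycle closes with \<open>x 1\<close>.\<close>
  define V where "V = (\<Union>i\<in>{1..n}. ball (x i) (r i))"
  define \<tau> where "\<tau> = min (\<rho> / 2) (\<eta> / B)"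
  have A1: "1 \<le> a" using A_ge_1 by (simp add: a_def)
  have \<eta>: "0 < \<eta>" using A1 by (simp add: \<eta>_def)
  have r: "\<eta> \<le> r i" for i using \<eta> A1 by (simp add: r_def one_le_power)
  have rn: "r n = 1 / a ^ n"
    using A1 by (simp add: r_def \<eta>_def mult_2 power_add)
  then have rn1: "r n \<le> 1" using A1 by (simp add: one_le_power)
  have r_le: "r i \<le> 1" if "i \<le> n" for i
  proof -
    have "r i \<le> r n" unfolding r_def
      using that \<eta> A1 by (intro mult_left_mono power_increasing) auto
    then show ?thesis using rn1 by simp
  qed
  have rn2: "r n * r n = \<eta>" by (simp add: rn \<eta>_def mult_2 power_add)
  have xn: "x n = c" by (simp add: x_def per)
  have xS: "x (Suc i) = poly q (x i)" for i by (simp add: x_def)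
  have x_le: "norm (x i) \<le> R" for i
  proof (rule periodic_norm_le[OF n])
    have "(poly q ^^ n) (x i) = (poly q ^^ i) ((poly q ^^ n) c)"
      unfolding x_def by (metis add.commute funpow_add o_apply)
    then show "(poly q ^^ n) (x i) = x i" by (simp add: per x_def)
  qed
  have near: "norm w \<le> R + 1" if "w \<in> ball (x i) (r i)" "i \<le> n" for w i
  proof -
    have "norm w \<le> norm (x i) + norm (w - x i)"
      by (metis add.commute diff_add_cancel norm_triangle_ineq)
    then show ?thesis
      using x_le[of i] r_le[OF that(2)] that(1) by (simp add: dist_norm norm_minus_commute)
  qed
  have "f s w \<in> V" if s: "norm s < \<tau>" and w: "w \<in> V" for s w
  proof -
    obtain i where i: "1 \<le> i" "i \<le> n" "w \<in> ball (x i) (r i)"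
      using w by (auto simp: V_def)
    have wi: "norm (w - x i) < r i" using i by (simp add: dist_norm norm_minus_commute)
    have "norm s \<le> \<eta> / B" using s by (simp add: \<tau>_def)
    then have Bs: "B * norm s \<le> \<eta>" using B_pos by (simp add: field_simps)
    have fs: "norm (f s w - poly q w) \<le> B * norm s"
      using s near[OF i(3,2)] by (intro f_pert) (auto simp: \<tau>_def)
    have tri: "norm (f s w - y) \<le> norm (poly q w - y) + B * norm s" for y
      using norm_triangle_ineq[of "f s w - poly q w" "poly q w - y"] fs by simp
    show ?thesis
    proof (cases "i = n")
      case False
      have "norm (poly q w - poly q (x i)) \<le> A * norm (w - x i)"
        by (rule poly_lipschitz[OF convex_ball A_bound[OF near]]) (use i \<eta> r[of i] in auto)
      also have "\<dots> < A * r i" using wi A_ge_1 by simp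
      finally have "norm (f s w - x (Suc i)) < A * r i + \<eta>"
        using tri[of "x (Suc i)"] Bs by (simp add: xS)
      also have "\<dots> \<le> A * r i + A * r i"
      proof -
        have "1 * \<eta> \<le> A * r i"
          using A_ge_1 r[of i] \<eta> by (intro mult_mono) auto
        then show ?thesis by linarith
      qed
      also have "\<dots> = r (Suc i)" by (simp add: r_def a_def)
      finally have "f s w \<in> ball (x (Suc i)) (r (Suc i))"
        by (simp add: dist_norm norm_minus_commute)
      then show ?thesis using i False by (auto simp: V_def)
    next
      case True
      have "norm (poly (pderiv q) u) \<le> A * r n" if "u \<in> ball c (r n)" for u
      proof -
        have "norm (poly (pderiv q) u) \<le> A * norm (u - c)"
          using near[of u n] that c xn by (intro A_crit) auto
        also have "\<dots> \<le> A * r n"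
          using that A_ge_1 by (intro mult_left_mono) (auto simp: dist_norm norm_minus_commute)
        finally show ?thesis .
      qed
      then have "norm (poly q w - poly q c) \<le> A * r n * norm (w - c)"
        by (rule poly_lipschitz[OF convex_ball]) (use i True xn \<eta> r[of n] in auto)
      also have "\<dots> < A * r n * r n"
        using wi True xn A_ge_1 \<eta> r[of n] by (intro mult_strict_left_mono) auto
      also have "\<dots> = A * \<eta>" by (simp add: rn2 mult.assoc)
      finally have "norm (f s w - x 1) < A * \<eta> + \<eta>"
        using tri[of "x 1"] Bs by (simp add: x_def)
      also have "\<dots> \<le> r 1" using A_ge_1 \<eta> by (simp add: r_def a_def)
      finally have "f s w \<in> ball (x 1) (r 1)"
        by (simp add: dist_norm norm_minus_commute)
      then show ?thesis using n by (auto simp: V_def Suc_le_eq)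
    qed
  qed
  moreover have "open V" "bounded V" by (auto simp: V_def)
  moreover have "c \<in> V"
  proof -
    have "c \<in> ball (x n) (r n)" using xn \<eta> r[of n] by simp
    then show ?thesis using n unfolding V_def by (intro UN_I[of n]) auto
  qed
  moreover have "0 < \<tau>" using \<rho>_pos \<eta> B_pos by (simp add: \<tau>_def)
  ultimately show ?thesis by blast
qed

text \<open>The traps of the finitely many critical points are united, a nonperiodic one
  contributing the empty set. A bounded set invariant under \<open>poly q\<close> lies in
  \<open>cball 0 R\<close>, because orbits outside this disk grow like \<open>2 ^ n\<close>.\<close>

lemma trap_exists:
  obtains V \<tau> where "open V" "V \<subseteq> cball 0 R" "\<forall>c\<in>crit. \<forall>n>0. (poly q ^^ n) c = c \<longrightarrow> c \<in> V"
    "0 < \<tau>" "\<tau> \<le> \<rho> / 2" "\<And>s w. \<lbrakk>norm s < \<tau>; w \<in> V\<rbrakk> \<Longrightarrow> f s w \<in> V"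
proof -
  define P where "P c V \<tau> \<longleftrightarrow> open V \<and> bounded V \<and> ((\<exists>n>0. (poly q ^^ n) c = c) \<longrightarrow> c \<in> V) \<and>
      0 < \<tau> \<and> (\<forall>s w. norm s < \<tau> \<longrightarrow> w \<in> V \<longrightarrow> f s w \<in> V)" for c V and \<tau> :: real
  have "\<exists>V \<tau>. P c V \<tau>" if "c \<in> crit" for c
  proof (cases "\<exists>n>0. (poly q ^^ n) c = c")
    case True
    then obtain n where n: "0 < n" "(poly q ^^ n) c = c" by blast
    obtain V \<tau> where "open V" "bounded V" "c \<in> V" "0 < \<tau>"
      "\<forall>s w. norm s < \<tau> \<longrightarrow> w \<in> V \<longrightarrow> f s w \<in> V"
      using superattracting_trap[OF \<open>c \<in> crit\<close> n] by (elim exE conjE)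
    then show ?thesis by (intro exI[of _ V] exI[of _ \<tau>]) (simp add: P_def)
  next
    case False
    then show ?thesis by (intro exI[of _ "{}"] exI[of _ 1]) (simp add: P_def)
  qed
  then obtain V \<tau> where P: "\<And>c. c \<in> crit \<Longrightarrow> P c (V c) (\<tau> c)"
    by metis
  have V: "open (V c) \<and> bounded (V c) \<and>
      ((\<exists>n>0. (poly q ^^ n) c = c) \<longrightarrow> c \<in> V c) \<and> 0 < \<tau> c \<and>
      (\<forall>s w. norm s < \<tau> c \<longrightarrow> w \<in> V c \<longrightarrow> f s w \<in> V c)" if "c \<in> crit" for c
    using P[OF that] unfolding P_def .
  define W where "W = (\<Union>c\<in>crit. V c)"
  define \<sigma> where "\<sigma> = Min (insert (\<rho> / 2) (\<tau> ` crit))"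
  have \<sigma>: "0 < \<sigma>" "\<sigma> \<le> \<rho> / 2" "\<And>c. c \<in> crit \<Longrightarrow> \<sigma> \<le> \<tau> c"
  proof -
    have fin: "finite (insert (\<rho> / 2) (\<tau> ` crit))" using finite_crit by simp
    show "0 < \<sigma>" unfolding \<sigma>_def using fin V \<rho>_pos by auto
    show "\<sigma> \<le> \<rho> / 2" "\<And>c. c \<in> crit \<Longrightarrow> \<sigma> \<le> \<tau> c"
      unfolding \<sigma>_def by (intro Min_le[OF fin]; simp)+
  qed
  have inv: "f s w \<in> W" if "norm s < \<sigma>" "w \<in> W" for s w
  proof -
    obtain c where c: "c \<in> crit" "w \<in> V c" using \<open>w \<in> W\<close> by (auto simp: W_def)
    then have "f s w \<in> V c" using V[OF c(1)] \<sigma>(3)[OF c(1)] that(1) by auto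
    then show ?thesis using c(1) by (auto simp: W_def)
  qed
  have "bounded W" unfolding W_def using finite_crit V by auto
  then obtain b where b: "\<And>w. w \<in> W \<Longrightarrow> norm w \<le> b" by (auto simp: bounded_iff)
  have "norm w \<le> R" if "w \<in> W" for w
  proof (rule ccontr)
    assume w: "\<not> norm w \<le> R"
    have "(poly q ^^ n) w \<in> W" for n
    proof (induction n)
      case (Suc n)
      then show ?case using inv[of 0] \<sigma>(1) by (simp add: f_zero)
    qed (use that in simp)
    then have "2 ^ n * norm w \<le> b" for n
      using orbit_escapes[of w n] w b by (meson not_le order_trans)
    moreover obtain n where "b / norm w < 2 ^ n" using real_arch_pow[of 2 "b / norm w"] by auto
    moreover have "0 < norm w" using w R_pos by linarith
    ultimately show False by (simp add: field_simps) (meson not_le mult.commute)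
  qed
  then have "W \<subseteq> cball 0 R" by auto
  moreover have "open W" unfolding W_def using V by auto
  moreover have "\<forall>c\<in>crit. \<forall>n>0. (poly q ^^ n) c = c \<longrightarrow> c \<in> W"
    unfolding W_def using V by blast
  ultimately show ?thesis using that inv \<sigma> by metis
qed

text \<open>The second coordinate of the \<open>n\<close>-th iterate of the skew product started at
  \<open>(t, z)\<close>.\<close>

primrec fib :: "complex \<Rightarrow> complex \<Rightarrow> complex \<Rightarrow> nat \<Rightarrow> complex" where
  "fib lam t z 0 = z"
| "fib lam t z (Suc n) = f (lam ^ n * t) (fib lam t z n)"

definition l :: nat where
  "l = degree q ^ (degree q - 1)"

end

section \<open>Shadowing of fiber orbits by polynomial orbits that avoid the trap\<close>

locale trapped_family = skew_family +
  fixes V :: "complex set" and \<tau> \<Theta> :: real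
  assumes V_bdd: "V \<subseteq> cball 0 R"
    and \<tau>_pos: "0 < \<tau>" and \<tau>_le: "\<tau> \<le> \<rho> / 2"
    and V_inv: "\<lbrakk>norm s < \<tau>; w \<in> V\<rbrakk> \<Longrightarrow> f s w \<in> V"
    and \<Theta>: "0 < \<Theta>" "\<Theta> \<le> 1"
    and \<Theta>_ball: "\<lbrakk>0 < e; e \<le> 1; \<And>j. j \<le> m \<Longrightarrow> norm ((poly q ^^ j) z) \<le> R \<and> (poly q ^^ j) z \<notin> V\<rbrakk> \<Longrightarrow>
      ball ((poly q ^^ Suc m) z) (\<Theta> ^ Suc m * e ^ l) \<subseteq> (poly q ^^ Suc m) ` ball z e"
begin

lemma poly_V: "w \<in> V \<Longrightarrow> poly q w \<in> V"
  using V_inv[of 0] \<tau>_pos by (simp add: f_zero)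

lemma orbit_V: "(poly q ^^ j) w \<in> V \<Longrightarrow> j \<le> n \<Longrightarrow> (poly q ^^ n) w \<in> V"
proof (induction n)
  case (Suc n)
  then show ?case using poly_V by (cases "j = Suc n") auto
qed simp

lemma orbit_stays_escaped: "R < norm ((poly q ^^ j) w) \<Longrightarrow> j \<le> n \<Longrightarrow> R < norm ((poly q ^^ n) w)"
proof (induction n)
  case (Suc n)
  then show ?case
    using orbit_escapes[of "(poly q ^^ n) w" 1] by (cases "j = Suc n") auto
qed simp

text \<open>The radius available at step \<open>n\<close> of \<open>shadowing\<close> is
  \<open>\<Theta> ^ Suc n * (e / 2 ^ (n + 2)) ^ l\<close>. Its part geometric in \<open>n\<close>
  dictates \<open>\<Theta> / 2 ^ l\<close>; the remaining constant, together with \<open>B\<close>,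
  dictates \<open>\<Theta> / (4 ^ l * B)\<close> in \<open>disk_const\<close>.\<close>

definition lam1 :: real where
  "lam1 = \<Theta> / 2 ^ l"

definition disk_const :: real where
  "disk_const = min \<tau> (\<Theta> / (4 ^ l * B))"

lemma lam1_pos: "0 < lam1" and disk_const_pos: "0 < disk_const"
  using \<Theta> \<tau>_pos B_pos by (auto simp: lam1_def disk_const_def)

lemma lam1_le: "lam1 \<le> 1"
proof -
  have "\<Theta> \<le> 2 ^ l" using \<Theta>(2) one_le_power[of "2::real" l] by linarith
  then show ?thesis by (simp add: lam1_def)
qed

lemma norm_fiber_le:
  fixes lam t :: complex
  assumes "norm lam < lam1" "norm t < disk_const * e ^ l" "0 < e" "e \<le> 1"
  shows "norm (lam ^ n * t) \<le> lam1 ^ n * norm t" "norm (lam ^ n * t) < \<tau>"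
proof -
  have "norm (lam ^ n * t) = norm lam ^ n * norm t" by (simp add: norm_mult norm_power)
  also have "\<dots> \<le> lam1 ^ n * norm t"
    using assms by (intro mult_right_mono power_mono) auto
  finally show 1: "norm (lam ^ n * t) \<le> lam1 ^ n * norm t" .
  also have "\<dots> \<le> 1 * norm t"
    using lam1_pos lam1_le by (intro mult_right_mono power_le_one) auto
  also have "\<dots> < disk_const * e ^ l" using assms by simp
  also have "\<dots> \<le> disk_const * 1"
    using disk_const_pos assms by (intro mult_left_mono power_le_one) auto
  also have "\<dots> \<le> \<tau>" by (simp add: disk_const_def)
  finally show "norm (lam ^ n * t) < \<tau>" .
qed

text \<open>While the orbit of \<open>y\<close> stays in the disk of radius \<open>R\<close> and
  outside \<open>V\<close>, \<open>\<Theta>_ball\<close> allows \<open>y\<close> to be moved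
  slightly so that its polynomial orbit hits the fiber orbit at the next time; the decay
  \<open>lam1 ^ n\<close> of the perturbation pays for the shrinking image balls. Only the values at
  the last time are matched. Entering \<open>V\<close> and passing \<open>R\<close> end the process
  and are therefore recorded.\<close>

lemma shadowing:
  assumes lam: "norm lam < lam1" and t: "norm t < disk_const * e ^ l" and e: "0 < e" "e \<le> 1"
    and z: "norm (z - z0) < e / 2"
  shows "(\<exists>y. norm (y - z0) < e * (1 - 1 / 2 ^ Suc n) \<and> (poly q ^^ n) y = fib lam t z n \<and>
        (\<forall>j\<le>n. norm ((poly q ^^ j) y) \<le> R \<and> (poly q ^^ j) y \<notin> V)) \<or>
    (\<exists>y\<in>ball z0 e. \<exists>m\<le>n. (poly q ^^ m) y \<in> V \<and> fib lam t z m \<in> V) \<or>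
    (\<exists>y\<in>ball z0 e. \<exists>m\<le>n. R < norm ((poly q ^^ m) y) \<and> R < norm (fib lam t z m))"
    (is "?follow n \<or> ?trap n \<or> ?escape n")
proof -
  \<comment> \<open>Being in \<open>V\<close> or beyond \<open>R\<close> at some time
    \<open>j\<close> persists under \<open>poly q\<close> until time \<open>n\<close>, where the two
    orbits agree; so the fiber orbit is there as well.\<close>
  have split: "?follow n \<or> ?trap n \<or> ?escape n"
    if y: "norm (y - z0) < e * (1 - 1 / 2 ^ Suc n)" "(poly q ^^ n) y = fib lam t z n" for n y
  proof -
    have "e * (1 - 1 / 2 ^ Suc n) \<le> e * 1" using e by (intro mult_left_mono) auto
    then have ball: "y \<in> ball z0 e" using y(1) by (simp add: dist_norm norm_minus_commute)
    consider "\<forall>j\<le>n. norm ((poly q ^^ j) y) \<le> R \<and> (poly q ^^ j) y \<notin> V"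
      | j where "j \<le> n" "(poly q ^^ j) y \<in> V" | j where "j \<le> n" "R < norm ((poly q ^^ j) y)"
      by fastforce
    then show ?thesis
    proof cases
      case 1
      then show ?thesis using y by blast
    next
      case 2
      then have "(poly q ^^ n) y \<in> V" using orbit_V by blast
      then have "?trap n" using ball y(2) by (intro bexI[of _ y] exI[of _ n]) auto
      then show ?thesis by blast
    next
      case 3
      then have "R < norm ((poly q ^^ n) y)" using orbit_stays_escaped by blast
      then have "?escape n" using ball y(2) by (intro bexI[of _ y] exI[of _ n]) auto
      then show ?thesis by blast
    qed
  qed
  show ?thesis
  proof (induction n)
    case 0
    show ?case by (rule split[of z]) (use z in auto)
  next
    case (Suc n)
    then consider "?follow n" | "?trap n" | "?escape n" by blast
    then show ?case
    proof cases
      case 1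
      then obtain y where y: "norm (y - z0) < e * (1 - 1 / 2 ^ Suc n)" "(poly q ^^ n) y = fib lam t z n"
        "\<And>j. j \<le> n \<Longrightarrow> norm ((poly q ^^ j) y) \<le> R \<and> (poly q ^^ j) y \<notin> V"
        by blast
      \<comment> \<open>The gap between the radii \<open>e * (1 - 1 / 2 ^ Suc n)\<close> and
        \<open>e * (1 - 1 / 2 ^ Suc (Suc n))\<close>, so that all corrections together stay below
        \<open>e\<close>.\<close>
      define e' where "e' = e / 2 ^ Suc (Suc n)"
      have e': "0 < e'" "e' \<le> 1"
        using e one_le_power[of "2::real" "Suc (Suc n)"] by (auto simp: e'_def field_simps)
      have fn: "norm (fib lam t z n) \<le> R" using y(3)[of n] y(2) by simp
      have "norm (fib lam t z (Suc n) - (poly q ^^ Suc n) y) \<le> B * norm (lam ^ n * t)"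
        using f_pert[of "lam ^ n * t" "fib lam t z n"] fn norm_fiber_le(2)[OF lam t e, of n] \<tau>_le
        by (simp add: y(2))
      also have "\<dots> \<le> B * (lam1 ^ n * norm t)"
        using norm_fiber_le(1)[OF lam t e] B_pos by (intro mult_left_mono) auto
      also have "\<dots> < B * (lam1 ^ n * (disk_const * e ^ l))"
        using t B_pos lam1_pos by (intro mult_strict_left_mono) auto
      also have "\<dots> \<le> B * (lam1 ^ n * (\<Theta> / (4 ^ l * B) * e ^ l))"
        using B_pos lam1_pos e by (intro mult_left_mono mult_right_mono) (auto simp: disk_const_def)
      also have "\<dots> = \<Theta> ^ Suc n * e' ^ l"
      proof -
        have p: "((2::real) ^ Suc (Suc n)) ^ l = 4 ^ l * (2 ^ l) ^ n"
          by (simp add: power_mult_distrib mult.commute flip: power_mult)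
        have "\<Theta> ^ Suc n * e' ^ l = \<Theta> ^ Suc n * (e ^ l / (4 ^ l * (2 ^ l) ^ n))"
          unfolding e'_def power_divide p ..
        also have "\<dots> = B * (lam1 ^ n * (\<Theta> / (4 ^ l * B) * e ^ l))"
          using B_pos by (simp add: lam1_def power_divide field_simps)
        finally show ?thesis by simp
      qed
      finally have "fib lam t z (Suc n) \<in> ball ((poly q ^^ Suc n) y) (\<Theta> ^ Suc n * e' ^ l)"
        by (simp add: dist_norm norm_minus_commute)
      then obtain y' where y': "y' \<in> ball y e'" "(poly q ^^ Suc n) y' = fib lam t z (Suc n)"
        using \<Theta>_ball[OF e' y(3)] by (metis imageE subsetD)
      have "norm (y' - z0) \<le> norm (y' - y) + norm (y - z0)"
        using norm_triangle_ineq[of "y' - y" "y - z0"] by simp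
      also have "\<dots> < e' + e * (1 - 1 / 2 ^ Suc n)"
        using y'(1) y(1) by (simp add: dist_norm norm_minus_commute)
      also have "\<dots> = e * (1 - 1 / 2 ^ Suc (Suc n))"
        by (simp add: e'_def field_simps)
      finally show ?thesis using split[OF _ y'(2)] by blast
    next
      case 2
      then have "?trap (Suc n)" by (meson le_SucI)
      then show ?thesis by blast
    next
      case 3
      then have "?escape (Suc n)" by (meson le_SucI)
      then show ?thesis by blast
    qed
  qed
qed

end

subsection \<open>Normality of bounded and of escaping families\<close>

lemma fatou_setI: "\<lbrakk>open U; U \<subseteq> X; normal_family_on U (range (\<lambda>n. g ^^ n)); x \<in> U\<rbrakk> \<Longrightarrow> x \<in> fatou_set X g"
  by (auto simp: fatou_set_def)

text \<open>A disk of radius \<open>r / 2\<close> about any point of \<open>cball x r\<close> fits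
  into \<open>ball x (2 * r)\<close>, so the Cauchy estimate bounds the derivative by
  \<open>2 * M / r\<close>.\<close>

lemma bounded_holomorphic_lipschitz:
  assumes hol: "g holomorphic_on ball x (2 * r)" and "0 < r"
    and M: "\<And>w. w \<in> ball x (2 * r) \<Longrightarrow> norm (g w) \<le> M"
    and "u \<in> cball x r" "v \<in> cball x r"
  shows "norm (g u - g v) \<le> 2 * M / r * norm (u - v)"
proof (rule field_differentiable_bound[OF convex_cball _ _ assms(4,5)])
  fix w assume w: "w \<in> cball x r"
  have sub: "cball w (r / 2) \<subseteq> ball x (2 * r)"
    using w \<open>0 < r\<close> by (auto intro!: mem_ball_leI simp: cball_subset_ball_iff dist_commute)
  then have wi: "w \<in> ball x (2 * r)" using w \<open>0 < r\<close> by auto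
  show "(g has_field_derivative deriv g w) (at w within cball x r)"
    using holomorphic_derivI[OF hol open_ball wi] has_field_derivative_at_within by blast
  have "norm ((deriv ^^ 1) g w) \<le> fact 1 * M / (r / 2) ^ 1"
  proof (rule Cauchy_inequality)
    show "g holomorphic_on ball w (r / 2)"
      using hol by (rule holomorphic_on_subset) (use sub ball_subset_cball in blast)
    show "continuous_on (cball w (r / 2)) g"
      using holomorphic_on_imp_continuous_on[OF hol] sub by (rule continuous_on_subset)
    show "norm (g u) \<le> M" if "norm (w - u) = r / 2" for u
      using that sub M by (auto simp: subset_iff dist_norm)
  qed (use \<open>0 < r\<close> in simp)
  then show "norm (deriv g w) \<le> 2 * M / r" by (simp add: mult.commute)
qed

text \<open>Cauchy estimates in each variable separately give a Lipschitz constant common to all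
  indices, and Arzela-Ascoli gives a uniformly convergent subsequence. \<open>L n\<close> stands for
  \<open>lam ^ n\<close>.\<close>

lemma normal_family_on_bounded_skew:
  fixes Q :: "nat \<Rightarrow> complex \<Rightarrow> complex \<Rightarrow> complex" and L :: "nat \<Rightarrow> complex"
  assumes r: "0 < r" and L: "\<And>n. norm (L n) \<le> 1"
    and holt: "\<And>n z. z \<in> ball z1 (2 * r) \<Longrightarrow> (\<lambda>t. Q n t z) holomorphic_on ball t1 (2 * r)"
    and holz: "\<And>n t. t \<in> ball t1 (2 * r) \<Longrightarrow> Q n t holomorphic_on ball z1 (2 * r)"
    and M: "\<And>n t z. \<lbrakk>t \<in> ball t1 (2 * r); z \<in> ball z1 (2 * r)\<rbrakk> \<Longrightarrow> norm (Q n t z) \<le> M"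
  shows "normal_family_on (ball t1 r \<times> ball z1 r) (range (\<lambda>n (t, z). (L n * t, Q n t z)))"
  unfolding normal_family_on_def
proof (intro allI impI)
  fix g :: "nat \<Rightarrow> complex \<times> complex \<Rightarrow> complex \<times> complex"
  assume "range g \<subseteq> range (\<lambda>n (t, z). (L n * t, Q n t z))"
  then have "\<forall>i. \<exists>n. g i = (\<lambda>(t, z). (L n * t, Q n t z))" by (simp add: image_subset_iff image_iff)
  from choice[OF this] obtain m where "\<forall>i. g i = (\<lambda>(t, z). (L (m i) * t, Q (m i) t z))"
    by (elim exE)
  then have m: "g i (t, z) = (L (m i) * t, Q (m i) t z)" for i t z
    by simp
  define S where "S = cball t1 r \<times> cball z1 r"
  define C where "C = 1 + 4 * M / r"
  have "0 \<le> M" using M[of t1 z1 0] r by (simp add: order_trans[OF norm_ge_zero])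
  then have C: "1 \<le> C" using r by (simp add: C_def)
  have lip: "norm (g i (t, z) - g i (t', z')) \<le> C * norm ((t, z) - (t', z'))"
    if "(t, z) \<in> S" "(t', z') \<in> S" for i t z t' z'
  proof -
    have in_ball: "t \<in> ball t1 (2 * r)" "t \<in> cball t1 r" "t' \<in> cball t1 r"
        "z' \<in> ball z1 (2 * r)" "z \<in> cball z1 r" "z' \<in> cball z1 r"
      using that r by (auto simp: S_def)
    have "norm (Q (m i) t z - Q (m i) t z') \<le> 2 * M / r * norm (z - z')"
      by (rule bounded_holomorphic_lipschitz[OF holz[OF in_ball(1)] r M[OF in_ball(1)]]) (use in_ball in auto)
    moreover have "norm (Q (m i) t z' - Q (m i) t' z') \<le> 2 * M / r * norm (t - t')"
      by (rule bounded_holomorphic_lipschitz[OF holt[OF in_ball(4)] r M]) (use in_ball in auto)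
    moreover have "norm (L (m i) * t - L (m i) * t') \<le> 1 * norm (t - t')"
      using L[of "m i"] by (simp add: norm_mult mult_left_le_one_le flip: right_diff_distrib)
    moreover have "norm (Q (m i) t z - Q (m i) t' z')
        \<le> norm (Q (m i) t z - Q (m i) t z') + norm (Q (m i) t z' - Q (m i) t' z')"
      using norm_triangle_ineq[of "Q (m i) t z - Q (m i) t z'" "Q (m i) t z' - Q (m i) t' z'"] by simp
    moreover have "norm (g i (t, z) - g i (t', z'))
        \<le> norm (L (m i) * t - L (m i) * t') + norm (Q (m i) t z - Q (m i) t' z')"
      using norm_Pair_le[of "L (m i) * t - L (m i) * t'" "Q (m i) t z - Q (m i) t' z'"] by (simp add: m)
    moreover have le: "norm (t - t') \<le> norm ((t, z) - (t', z'))" "norm (z - z') \<le> norm ((t, z) - (t', z'))"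
      using norm_fst_le[of "t - t'" "z - z'"] norm_snd_le[of "z - z'" "t - t'"] by auto
    have "2 * M / r * norm (z - z') \<le> 2 * M / r * norm ((t, z) - (t', z'))"
      "2 * M / r * norm (t - t') \<le> 2 * M / r * norm ((t, z) - (t', z'))"
      "1 * norm (t - t') \<le> 1 * norm ((t, z) - (t', z'))"
      by (intro mult_left_mono le; use \<open>0 \<le> M\<close> r in simp)+
    moreover have "C * norm ((t, z) - (t', z')) = 1 * norm ((t, z) - (t', z'))
        + 2 * M / r * norm ((t, z) - (t', z')) + 2 * M / r * norm ((t, z) - (t', z'))"
      by (simp add: C_def algebra_simps)
    ultimately show ?thesis by linarith
  qed
  obtain h k where hk: "continuous_on S h" "strict_mono (k :: nat \<Rightarrow> nat)"
    "\<And>e. 0 < e \<Longrightarrow> \<exists>N. \<forall>n x. n \<ge> N \<and> x \<in> S \<longrightarrow> norm (g (k n) x - h x) < e"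
  proof (rule Arzela_Ascoli[of S g "(norm t1 + r) + M"])
    show "compact S" unfolding S_def by (intro compact_Times compact_cball)
    show "norm (g n x) \<le> (norm t1 + r) + M" if "x \<in> S" for n x
    proof (cases x)
      case (Pair t z)
      then have tz: "dist t1 t \<le> r" "t \<in> ball t1 (2 * r)" "z \<in> ball z1 (2 * r)"
        using that r by (auto simp: S_def)
      have "norm (L (m n) * t) \<le> 1 * norm t"
        unfolding norm_mult using L[of "m n"] by (intro mult_right_mono) auto
      moreover have "norm t \<le> norm t1 + r"
        using tz(1) norm_triangle_ineq[of t1 "t - t1"] by (simp add: dist_norm norm_minus_commute)
      ultimately show ?thesis
        using norm_Pair_le[of "L (m n) * t" "Q (m n) t z"] M[OF tz(2,3), of "m n"]
        by (simp add: Pair m)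
    qed
    show "\<exists>d>0. \<forall>n y. y \<in> S \<and> norm (x - y) < d \<longrightarrow> norm (g n x - g n y) < e"
      if "x \<in> S" "0 < e" for x e
    proof (intro exI[of _ "e / C"] conjI allI impI)
      show "0 < e / C" using C \<open>0 < e\<close> by simp
      fix n y assume y: "y \<in> S \<and> norm (x - y) < e / C"
      then have "norm (g n x - g n y) \<le> C * norm (x - y)"
        using lip[of "fst x" "snd x" "fst y" "snd y" n] \<open>x \<in> S\<close> by simp
      also have "\<dots> < e" using y C by (simp add: field_simps)
      finally show "norm (g n x - g n y) < e" .
    qed
  qed blast
  have "uniform_limit (ball t1 r \<times> ball z1 r) (g \<circ> k) h sequentially"
    unfolding uniform_limit_iff
  proof (intro allI impI)
    fix e :: real assume "0 < e"
    then obtain N where N: "\<And>n x. \<lbrakk>n \<ge> N; x \<in> S\<rbrakk> \<Longrightarrow> norm (g (k n) x - h x) < e"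
      using hk(3) by blast
    show "\<forall>\<^sub>F n in sequentially. \<forall>x\<in>ball t1 r \<times> ball z1 r. dist ((g \<circ> k) n x) (h x) < e"
      using eventually_ge_at_top[of N]
      by eventually_elim (auto simp: S_def dist_norm intro!: N)
  qed
  then have "loc_unif_conv_ext (ball t1 r \<times> ball z1 r) (g \<circ> k)"
    unfolding loc_unif_conv_ext_def
    by (intro ballI exI[of _ "ball t1 r \<times> ball z1 r"]) (auto simp: open_Times)
  then show "\<exists>s. strict_mono s \<and> loc_unif_conv_ext (ball t1 r \<times> ball z1 r) (g \<circ> s)"
    using hk(2) by blast
qed

text \<open>The definition of normality admits sequences of iterates in any order and with
  repetitions; these are the two cases to which they reduce.\<close>

lemma subseq_const_or_at_top:
  fixes m :: "nat \<Rightarrow> nat"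
  obtains s :: "nat \<Rightarrow> nat" where "strict_mono s" "\<And>i. m (s i) = m (s 0)"
  | s :: "nat \<Rightarrow> nat" where "strict_mono s" "filterlim (m \<circ> s) at_top sequentially"
proof (cases "finite (range m)")
  case True
  then have "\<exists>a\<in>UNIV. infinite {i\<in>UNIV. m i = m a}"
    by (intro pigeonhole_infinite) auto
  then obtain a where "infinite {i. m i = m a}" by auto
  from infinite_enumerate[OF this] obtain s :: "nat \<Rightarrow> nat" where "strict_mono s" "\<forall>i. s i \<in> {i. m i = m a}"
    by (elim exE conjE)
  then show ?thesis using that(1)[of s] by simp
next
  case False
  have "\<exists>y>x. n \<le> m y" for x n
  proof (rule ccontr)
    assume "\<not> ?thesis"
    then have "m y \<le> n" if "x < y" for y using that by (meson nat_le_linear)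
    then have "range m \<subseteq> m ` {..x} \<union> {..n}" by (fastforce simp: not_le[symmetric])
    then show False using False by (meson finite_Un finite_atMost finite_imageI finite_subset)
  qed
  then have "\<exists>s. \<forall>n. n \<le> m (s n) \<and> s n < s (Suc n)"
    by (intro dependent_nat_choice[where P="\<lambda>n x. n \<le> m x" and Q="\<lambda>_ x y. x < y"]) auto
  then obtain s where s: "\<And>n. n \<le> m (s n)" "\<And>n. s n < s (Suc n)" by blast
  have "filterlim (m \<circ> s) at_top sequentially"
    by (rule filterlim_at_top_mono[OF filterlim_ident]) (simp add: s)
  then show ?thesis using that(2)[of s] s(2) by (simp add: strict_mono_Suc_iff)
qed

text \<open>A subsequence with constant index converges trivially; one whose index tends to infinity
  diverges locally uniformly by \<open>esc\<close>.\<close>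

lemma normal_family_on_escaping:
  fixes F :: "nat \<Rightarrow> 'a::real_normed_vector \<Rightarrow> 'b::real_normed_vector"
  assumes U: "open U"
    and esc: "\<And>x. x \<in> U \<Longrightarrow> \<exists>V. open V \<and> x \<in> V \<and> V \<subseteq> U \<and>
      (\<forall>B. \<forall>\<^sub>F n in sequentially. \<forall>y\<in>V. B < norm (F n y))"
  shows "normal_family_on U (range F)"
  unfolding normal_family_on_def
proof (intro allI impI)
  fix g :: "nat \<Rightarrow> 'a \<Rightarrow> 'b" assume "range g \<subseteq> range F"
  then have "\<forall>i. \<exists>n. g i = F n" by (simp add: image_subset_iff image_iff)
  from choice[OF this] obtain m where m: "\<And>i. g i = F (m i)" by auto
  show "\<exists>s. strict_mono s \<and> loc_unif_conv_ext U (g \<circ> s)"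
  proof (rule subseq_const_or_at_top[of m])
    fix s :: "nat \<Rightarrow> nat" assume s: "strict_mono s" "\<And>i. m (s i) = m (s 0)"
    have "(g \<circ> s) = (\<lambda>_. F (m (s 0)))"
    proof
      show "(g \<circ> s) i = F (m (s 0))" for i using s(2)[of i] by (simp add: m)
    qed
    then have "uniform_limit U (g \<circ> s) (F (m (s 0))) sequentially"
      by (simp add: uniform_limit_iff)
    then have "loc_unif_conv_ext U (g \<circ> s)"
      unfolding loc_unif_conv_ext_def using U by blast
    then show ?thesis using s(1) by blast
  next
    fix s :: "nat \<Rightarrow> nat" assume s: "strict_mono s" "filterlim (m \<circ> s) at_top sequentially"
    have "loc_unif_conv_ext U (g \<circ> s)"
      unfolding loc_unif_conv_ext_def
    proof
      fix x assume "x \<in> U"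
      then obtain V where V: "open V" "x \<in> V" "V \<subseteq> U"
        "\<And>B. \<forall>\<^sub>F n in sequentially. \<forall>y\<in>V. B < norm (F n y)"
        using esc by blast
      have "\<forall>\<^sub>F n in sequentially. \<forall>y\<in>V. B < norm ((g \<circ> s) n y)" for B
        using eventually_compose_filterlim[OF V(4) s(2), of B]
        by (simp add: m)
      then show "\<exists>V. open V \<and> x \<in> V \<and> V \<subseteq> U \<and> ((\<exists>h. uniform_limit V (g \<circ> s) h sequentially) \<or>
          (\<forall>B. \<forall>\<^sub>F n in sequentially. \<forall>y\<in>V. B < norm ((g \<circ> s) n y)))"
        using V by blast
    qed
    then show ?thesis using s(1) by blast
  qed
qed

section \<open>Fatou set and filled Julia set of the fiber polynomial\<close>

context escape_poly
begin

definition filled_julia :: "complex set" where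
  "filled_julia = {z. \<forall>n. norm ((poly q ^^ n) z) \<le> R}"

lemma continuous_iterate: "continuous_on S (poly q ^^ n)"
  by (induction n) (auto intro!: continuous_intros continuous_on_compose2[of UNIV "poly q"]
      simp: o_def)

lemma open_escaping: "open (- filled_julia)"
proof -
  have "- filled_julia = (\<Union>n. {z. R < norm ((poly q ^^ n) z)})"
    unfolding filled_julia_def by (auto simp flip: not_le)
  moreover have "open {z. R < norm ((poly q ^^ n) z)}" for n
    by (intro open_Collect_less continuous_intros continuous_iterate)
  ultimately show ?thesis by auto
qed

lemma escaping_eventually:
  assumes "R < norm ((poly q ^^ j) z)"
  shows "\<forall>\<^sub>F n in sequentially. K < norm ((poly q ^^ n) z)"
proof -
  obtain N :: nat where N: "K / R < N" using reals_Archimedean2 by blast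
  have "K < norm ((poly q ^^ n) z)" if "n \<ge> N + j" for n
  proof -
    have "K < N * R" using N R_pos by (simp add: field_simps)
    also have "\<dots> \<le> 2 ^ (n - j) * norm ((poly q ^^ j) z)"
    proof (rule mult_mono)
      have "N \<le> n - j" using that by simp
      then show "real N \<le> 2 ^ (n - j)"
        by (meson less_exp le_trans less_imp_le of_nat_le_numeral_power_cancel_iff)
    qed (use assms R_pos in auto)
    also have "\<dots> \<le> norm ((poly q ^^ (n - j + j)) z)"
      using orbit_escapes[OF assms, of "n - j"] by (simp add: funpow_add del: le_add_diff_inverse2)
    finally show ?thesis using that by simp
  qed
  then show ?thesis by (auto simp: eventually_sequentially)
qed

text \<open>At a point of \<open>filled_julia\<close> no subsequence of the iterates diverges to
  infinity, so one converges uniformly nearby. A point at which it converges cannot escape, hence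
  the whole neighbourhood belongs to \<open>filled_julia\<close>.\<close>

lemma open_fatou_filled: "open (fatou_set UNIV (poly q) \<inter> filled_julia)"
proof (subst open_subopen, intro ballI)
  fix x assume x: "x \<in> fatou_set UNIV (poly q) \<inter> filled_julia"
  then obtain U where U: "open U" "normal_family_on U (range (\<lambda>n. poly q ^^ n))" "x \<in> U"
    by (auto simp: fatou_set_def)
  obtain s where s: "strict_mono s" "loc_unif_conv_ext U ((\<lambda>n. poly q ^^ n) \<circ> s)"
    using U(2) unfolding normal_family_on_def by (elim allE impE) (auto intro: subset_refl)
  obtain V where V: "open V" "x \<in> V" "V \<subseteq> U"
    "(\<exists>h. uniform_limit V ((\<lambda>n. poly q ^^ n) \<circ> s) h sequentially) \<or>
         (\<forall>B. \<forall>\<^sub>F n in sequentially. \<forall>y\<in>V. B < norm (((\<lambda>n. poly q ^^ n) \<circ> s) n y))"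
    using s(2) U(3) unfolding loc_unif_conv_ext_def by blast
  have "\<not> (\<forall>\<^sub>F n in sequentially. \<forall>y\<in>V. R < norm (((\<lambda>n. poly q ^^ n) \<circ> s) n y))"
  proof
    assume "\<forall>\<^sub>F n in sequentially. \<forall>y\<in>V. R < norm (((\<lambda>n. poly q ^^ n) \<circ> s) n y)"
    then obtain n where "R < norm ((poly q ^^ s n) x)"
      using V(2) by (auto simp: eventually_sequentially)
    then show False using x by (auto simp: filled_julia_def not_le[symmetric])
  qed
  then obtain h where h: "uniform_limit V ((\<lambda>n. poly q ^^ n) \<circ> s) h sequentially"
    using V(4) by blast
  have "V \<subseteq> filled_julia"
  proof
    fix y assume y: "y \<in> V"
    have lim: "(\<lambda>n. (poly q ^^ s n) y) \<longlonglongrightarrow> h y"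
      using tendsto_uniform_limitI[OF h y] by simp
    show "y \<in> filled_julia"
    proof (rule ccontr)
      assume "y \<notin> filled_julia"
      then obtain j where "R < norm ((poly q ^^ j) y)" by (auto simp: filled_julia_def not_le)
      then have esc: "\<forall>\<^sub>F n in sequentially. norm (h y) + 1 < norm ((poly q ^^ s n) y)"
        by (rule eventually_compose_filterlim[OF escaping_eventually filterlim_subseq[OF s(1)]])
      have "\<forall>\<^sub>F n in sequentially. norm ((poly q ^^ s n) y) < norm (h y) + 1"
        using tendsto_norm[OF lim] by (rule order_tendstoD) simp
      with esc have "\<forall>\<^sub>F n in sequentially. False"
        by eventually_elim simp
      then show False by simp
    qed
  qed
  moreover have "V \<subseteq> fatou_set UNIV (poly q)"
    using V(3) U by (auto intro: fatou_setI)
  ultimately show "\<exists>T. open T \<and> x \<in> T \<and> T \<subseteq> fatou_set UNIV (poly q) \<inter> filled_julia"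
    using V by blast
qed

text \<open>Within the Fatou set both \<open>filled_julia\<close> and its complement are open, and
  the ball is connected. Nothing else about Fatou components is used.\<close>

lemma fatou_ball_cases:
  assumes "ball z e \<subseteq> fatou_set UNIV (poly q)"
  obtains "ball z e \<subseteq> filled_julia" | "ball z e \<inter> filled_julia = {}"
proof -
  have "connected (ball z e)" by simp
  then have "fatou_set UNIV (poly q) \<inter> filled_julia \<inter> ball z e = {} \<or> - filled_julia \<inter> ball z e = {}"
    using open_fatou_filled open_escaping by (rule connectedD) (use assms in auto)
  then show ?thesis using assms that by blast
qed

end

subsection \<open>The radius of constant disks\<close>

lemma open_fatou_set: "open (fatou_set X g)"
  by (auto simp: fatou_set_def)

lemma ball_infdist_julia_subset: "ball z (infdist z (julia_set UNIV g)) \<subseteq> fatou_set UNIV g"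
  using infdist_le[of _ "julia_set UNIV g" z] by (fastforce simp: julia_set_def)

text \<open>The coefficients are Lipschitz on the closed disk of radius \<open>\<rho> / 2\<close>,
  where their derivatives are bounded by compactness; on all of \<open>ball 0 \<rho>\<close> these
  may be unbounded.\<close>

lemma fiber_map_perturbation:
  assumes \<rho>: "0 < \<rho>" and a: "\<And>i. i \<le> d \<Longrightarrow> a i holomorphic_on ball 0 \<rho>" and "0 \<le> M"
  obtains B where "0 < B" "\<And>t z. \<lbrakk>norm t \<le> \<rho> / 2; norm z \<le> M\<rbrakk> \<Longrightarrow>
    norm (fiber_map d a t z - fiber_map d a 0 z) \<le> B * norm t"
proof -
  have sub: "cball 0 (\<rho> / 2) \<subseteq> ball (0::complex) \<rho>" using \<rho> by auto
  have "\<exists>C\<ge>0. \<forall>t\<in>cball 0 (\<rho> / 2). norm (a i t - a i 0) \<le> C * norm t" if "i \<le> d" for i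
  proof -
    have "continuous_on (cball 0 (\<rho> / 2)) (deriv (a i))"
      using holomorphic_deriv[OF a[OF that] open_ball] sub
      by (meson continuous_on_subset holomorphic_on_imp_continuous_on)
    then have "bounded (deriv (a i) ` cball 0 (\<rho> / 2))"
      by (intro compact_imp_bounded compact_continuous_image compact_cball)
    then obtain C where C: "\<And>t. t \<in> cball 0 (\<rho> / 2) \<Longrightarrow> norm (deriv (a i) t) \<le> C"
      unfolding bounded_iff by blast
    have "norm (a i t - a i 0) \<le> C * norm (t - 0)" if t: "t \<in> cball 0 (\<rho> / 2)" for t
    proof (rule field_differentiable_bound[OF convex_cball _ C t])
      fix w :: complex assume "w \<in> cball 0 (\<rho> / 2)"
      then have "w \<in> ball 0 \<rho>" using sub by blast
      then show "(a i has_field_derivative deriv (a i) w) (at w within cball 0 (\<rho> / 2))"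
        using holomorphic_derivI[OF a[OF \<open>i \<le> d\<close>] open_ball] has_field_derivative_at_within by blast
    qed (use \<rho> in auto)
    moreover have "0 \<le> C" using C[of 0] \<rho> by (simp add: order_trans[OF norm_ge_zero])
    ultimately show ?thesis by auto
  qed
  then have "\<forall>i\<in>{..d}. \<exists>C\<ge>0. \<forall>t\<in>cball 0 (\<rho> / 2). norm (a i t - a i 0) \<le> C * norm t"
    by simp
  from bchoice[OF this] obtain C where
    C0: "\<forall>i\<in>{..d}. 0 \<le> C i \<and> (\<forall>t\<in>cball 0 (\<rho> / 2). norm (a i t - a i 0) \<le> C i * norm t)"
    by blast
  have C: "0 \<le> C i" "norm t \<le> \<rho> / 2 \<Longrightarrow> norm (a i t - a i 0) \<le> C i * norm t" if "i \<le> d" for i t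
  proof -
    show "0 \<le> C i" using C0 that by blast
    show "norm (a i t - a i 0) \<le> C i * norm t" if "norm t \<le> \<rho> / 2"
    proof -
      have "t \<in> cball 0 (\<rho> / 2)" using that by simp
      then show ?thesis using C0 \<open>i \<le> d\<close> by blast
    qed
  qed
  define B where "B = 1 + (\<Sum>i\<le>d. C i * M ^ i)"
  have "0 < B" unfolding B_def using C \<open>0 \<le> M\<close>
    by (intro add_pos_nonneg sum_nonneg mult_nonneg_nonneg) auto
  moreover have "norm (fiber_map d a t z - fiber_map d a 0 z) \<le> B * norm t"
    if "norm t \<le> \<rho> / 2" "norm z \<le> M" for t z
  proof -
    have "norm (fiber_map d a t z - fiber_map d a 0 z) = norm (\<Sum>i\<le>d. (a i t - a i 0) * z ^ i)"
      by (simp add: fiber_map_def sum_subtractf algebra_simps)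
    also have "\<dots> \<le> (\<Sum>i\<le>d. (C i * norm t) * M ^ i)"
    proof (rule sum_norm_le)
      fix i assume "i \<in> {..d}"
      then show "norm ((a i t - a i 0) * z ^ i) \<le> (C i * norm t) * M ^ i"
        unfolding norm_mult norm_power using that C
        by (intro mult_mono power_mono mult_nonneg_nonneg) auto
    qed
    also have "\<dots> = (\<Sum>i\<le>d. C i * M ^ i) * norm t"
      by (simp add: sum_distrib_left mult_ac)
    also have "\<dots> \<le> B * norm t" by (intro mult_right_mono) (auto simp: B_def)
    finally show ?thesis .
  qed
  ultimately show ?thesis using that by blast
qed

lemma fiber_map_eq_poly:
  assumes "a d 0 \<noteq> 0"
  obtains q where "fiber_map d a 0 = poly q" "degree q = d"
proof
  let ?q = "\<Sum>i\<le>d. monom (a i 0) i"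
  show "fiber_map d a 0 = poly ?q"
    by (simp add: fiber_map_def fun_eq_iff poly_sum poly_monom)
  have "coeff ?q d = a d 0" by (simp add: coeff_sum)
  then have "d \<le> degree ?q" using assms by (intro le_degree) simp
  moreover have "degree ?q \<le> d"
    by (intro degree_sum_le) (auto intro: order_trans[OF degree_monom_le])
  ultimately show "degree ?q = d" by simp
qed

lemma disk_radius_geI:
  assumes "0 < r" "norm z \<le> R" "0 \<in> \<Delta>"
    and "\<And>t. \<lbrakk>t \<in> \<Delta>; norm t < 2 * r\<rbrakk> \<Longrightarrow> (t, z) \<in> fatou_set (\<Delta> \<times> UNIV) P"
  shows "ereal r \<le> disk_radius \<Delta> P R z"
proof -
  let ?D = "{(t, w). t \<in> \<Delta> \<and> w = z \<and> norm t < 2 * r}"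
  have "horizontal_disk \<Delta> (2 * r) ?D"
    unfolding horizontal_disk_def using assms(1) by (intro conjI exI[of _ "\<lambda>_. z"]) auto
  moreover have "(0, z) \<in> ?D" using assms by simp
  moreover have "?D \<subseteq> fatou_set (\<Delta> \<times> UNIV) P \<inter> {(t, w). norm w \<le> R}"
    using assms by auto
  ultimately show ?thesis unfolding disk_radius_def using assms(1) by (intro Sup_upper) blast
qed

section \<open>Normality criteria for the skew product and the size of constant disks\<close>

locale holomorphic_family = trapped_family +
  fixes d :: nat and a :: "nat \<Rightarrow> complex \<Rightarrow> complex"
  assumes a_hol: "i \<le> d \<Longrightarrow> a i holomorphic_on ball 0 \<rho>"
    and f_eq: "f = fiber_map d a"
begin

lemma skew_iterate: "(skew_product lam f ^^ n) (t, z) = (lam ^ n * t, fib lam t z n)"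
  by (induction n) (auto simp: skew_product_def)

lemma fib_Suc: "fib lam t z (Suc n) = (\<Sum>i\<le>d. a i (lam ^ n * t) * fib lam t z n ^ i)"
  using fun_cong[OF fun_cong[OF f_eq], of "lam ^ n * t" "fib lam t z n"]
  by (simp add: fiber_map_def)

lemma norm_power_mult_less:
  fixes lam t :: complex
  assumes "norm lam \<le> 1" "norm t < \<rho>"
  shows "norm (lam ^ n * t) < \<rho>"
proof -
  have "norm (lam ^ n * t) \<le> norm t"
    using assms(1) by (simp add: norm_mult norm_power mult_left_le_one_le power_le_one)
  then show ?thesis using assms(2) by simp
qed

lemma holomorphic_fib_t:
  assumes "norm lam \<le> 1"
  shows "(\<lambda>t. fib lam t z n) holomorphic_on ball 0 \<rho>"
proof (induction n)
  case (Suc n)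
  have "(\<lambda>t. a i (lam ^ n * t)) holomorphic_on ball 0 \<rho>" if "i \<le> d" for i
  proof -
    have "(\<lambda>t. lam ^ n * t) ` ball 0 \<rho> \<subseteq> ball 0 \<rho>"
      using norm_power_mult_less[OF assms] by auto
    from holomorphic_on_compose_gen[OF _ a_hol[OF that] this] show ?thesis
      by (simp add: o_def holomorphic_intros)
  qed
  then show ?case
    using Suc unfolding fib_Suc by (intro holomorphic_intros; simp)
qed simp

lemma holomorphic_fib_z: "(\<lambda>z. fib lam t z n) holomorphic_on S"
  by (induction n) (auto simp: fib_Suc simp del: fib.simps(2) intro!: holomorphic_intros)

lemma continuous_on_fib:
  assumes "norm lam \<le> 1"
  shows "continuous_on (ball 0 \<rho> \<times> UNIV) (\<lambda>x. fib lam (fst x) (snd x) n)"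
proof (induction n)
  case (Suc n)
  have "continuous_on (ball 0 \<rho> \<times> UNIV) (\<lambda>x. a i (lam ^ n * fst x))" if "i \<le> d" for i
    using norm_power_mult_less[OF assms]
    by (intro continuous_on_compose2[OF holomorphic_on_imp_continuous_on[OF a_hol[OF that]]] continuous_intros) auto
  then show ?case
    using Suc unfolding fib_Suc by (intro continuous_intros; simp)
qed (simp add: continuous_intros)

lemma fib_escapes:
  assumes "norm lam \<le> 1" "norm t < \<rho>" "R < norm (fib lam t z j)"
  shows "2 ^ n * R \<le> norm (fib lam t z (j + n)) \<and> R < norm (fib lam t z (j + n))"
proof (induction n)
  case (Suc n)
  then show ?case
    using f_esc[OF norm_power_mult_less[OF assms(1,2)], of "fib lam t z (j + n)" "j + n"] R_pos by simp
qed (use assms in simp)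

lemma fatou_if_bounded:
  assumes lam: "norm lam \<le> 1" and \<sigma>: "0 < \<sigma>" "\<sigma> \<le> \<rho>" and e: "0 < e" and t: "norm t1 < \<sigma>"
    and bdd: "\<And>t z n. \<lbrakk>norm t < \<sigma>; z \<in> ball z1 e\<rbrakk> \<Longrightarrow> norm (fib lam t z n) \<le> R"
  shows "(t1, z1) \<in> fatou_set (ball 0 \<rho> \<times> UNIV) (skew_product lam f)"
proof -
  \<comment> \<open>Half of the room in each variable, because
    \<open>normal_family_on_bounded_skew\<close> needs bounds on balls of radius
    \<open>2 * r\<close>.\<close>
  define r where "r = min ((\<sigma> - norm t1) / 2) (e / 2)"
  have r: "0 < r" using t e by (simp add: r_def)
  have subt: "ball t1 (2 * r) \<subseteq> ball 0 \<sigma>"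
  proof
    fix t assume "t \<in> ball t1 (2 * r)"
    then have "norm t < norm t1 + 2 * r"
      using norm_triangle_ineq[of t1 "t - t1"] by (simp add: dist_norm norm_minus_commute)
    moreover have "r \<le> (\<sigma> - norm t1) / 2" by (simp only: r_def min.cobounded1)
    ultimately show "t \<in> ball 0 \<sigma>" by simp
  qed
  have subz: "ball z1 (2 * r) \<subseteq> ball z1 e" by (rule subset_ball) (simp add: r_def)
  have iter: "range (\<lambda>n. skew_product lam f ^^ n) = range (\<lambda>n (t, z). (lam ^ n * t, fib lam t z n))"
    by (intro arg_cong[of _ _ range]) (auto simp: fun_eq_iff skew_iterate)
  have "normal_family_on (ball t1 r \<times> ball z1 r) (range (\<lambda>n (t, z). (lam ^ n * t, fib lam t z n)))"
  proof (rule normal_family_on_bounded_skew[OF r])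
    show "norm (lam ^ n) \<le> 1" for n using lam by (simp add: norm_power power_le_one)
    show "(\<lambda>t. fib lam t z n) holomorphic_on ball t1 (2 * r)" for n z
      using holomorphic_fib_t[OF lam] by (rule holomorphic_on_subset) (use subt \<sigma> in auto)
    show "(\<lambda>z. fib lam t z n) holomorphic_on ball z1 (2 * r)" for n t
      by (rule holomorphic_fib_z)
    show "norm (fib lam t z n) \<le> R" if "t \<in> ball t1 (2 * r)" "z \<in> ball z1 (2 * r)" for n t z
      using that subt subz by (intro bdd) auto
  qed
  then show ?thesis
    unfolding iter[symmetric]
  proof (rule fatou_setI[rotated 2])
    have "ball t1 r \<subseteq> ball t1 (2 * r)" using r by (intro subset_ball) simp
    also have "\<dots> \<subseteq> ball 0 \<rho>" using subt subset_ball[OF \<sigma>(2), of 0] by (rule subset_trans)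
    finally show "ball t1 r \<times> ball z1 r \<subseteq> ball 0 \<rho> \<times> UNIV" by (rule Sigma_mono) simp
  qed (use r in \<open>auto simp: open_Times\<close>)
qed

text \<open>Being beyond \<open>R\<close> at a fixed time is an open condition on
  \<open>(t, z)\<close>, and from then on the norm at least doubles at each step. So divergence is
  uniform near every point.\<close>

lemma fatou_if_escaping:
  assumes lam: "norm lam \<le> 1" and U: "open U" "U \<subseteq> ball 0 \<rho> \<times> UNIV" and x: "x \<in> U"
    and esc: "\<And>t z. (t, z) \<in> U \<Longrightarrow> \<exists>n. R < norm (fib lam t z n)"
  shows "x \<in> fatou_set (ball 0 \<rho> \<times> UNIV) (skew_product lam f)"
proof (rule fatou_setI[OF U _ x])
  show "normal_family_on U (range (\<lambda>n. skew_product lam f ^^ n))"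
  proof (rule normal_family_on_escaping[OF U(1)])
    fix x assume "x \<in> U"
    then obtain j where j: "R < norm (fib lam (fst x) (snd x) j)"
      using esc[of "fst x" "snd x"] by auto
    define V where "V = U \<inter> {x \<in> ball 0 \<rho> \<times> UNIV. fib lam (fst x) (snd x) j \<in> - cball 0 R}"
    have "open {x \<in> ball 0 \<rho> \<times> UNIV. fib lam (fst x) (snd x) j \<in> - cball 0 R}"
      by (rule continuous_open_preimage[OF continuous_on_fib[OF lam], unfolded vimage_def Int_def mem_Collect_eq])
         (auto simp: open_Times open_Compl)
    then have "open V" using U(1) by (auto simp: V_def)
    moreover have "x \<in> V" using \<open>x \<in> U\<close> U(2) j by (auto simp: V_def)
    moreover have "\<forall>\<^sub>F n in sequentially. \<forall>y\<in>V. K < norm ((skew_product lam f ^^ n) y)" for K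
    proof -
      obtain N :: nat where N: "K / R < N" using reals_Archimedean2 by blast
      have "K < norm ((skew_product lam f ^^ n) y)" if n: "n \<ge> j + N" and "y \<in> V" for n y
      proof -
        obtain t z where y: "y = (t, z)" by (cases y)
        have tz: "norm t < \<rho>" "R < norm (fib lam t z j)"
          using \<open>y \<in> V\<close> by (auto simp: V_def y)
        have "K < N * R" using N R_pos by (simp add: field_simps)
        also have "\<dots> \<le> 2 ^ (n - j) * R"
        proof (intro mult_right_mono)
          have "N \<le> n - j" using n by simp
          then show "real N \<le> 2 ^ (n - j)"
            by (meson less_exp le_trans less_imp_le of_nat_le_numeral_power_cancel_iff)
        qed (use R_pos in simp)
        also have "\<dots> \<le> norm (fib lam t z n)"
          using fib_escapes[OF lam tz, of "n - j"] n by simp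
        also have "\<dots> \<le> norm ((skew_product lam f ^^ n) y)"
          by (simp add: y skew_iterate norm_snd_le)
        finally show ?thesis .
      qed
      then show ?thesis unfolding eventually_sequentially by blast
    qed
    ultimately show "\<exists>V. open V \<and> x \<in> V \<and> V \<subseteq> U \<and>
        (\<forall>B. \<forall>\<^sub>F n in sequentially. \<forall>y\<in>V. B < norm ((skew_product lam f ^^ n) y))"
      by (intro exI[of _ V]) (auto simp: V_def)
  qed
qed

text \<open>If the ball lies in the filled Julia set, the escape alternative of
  \<open>shadowing\<close> is impossible and the other two keep the fiber orbit in
  \<open>cball 0 R\<close>. If it is disjoint from it, a bounded fiber orbit would be shadowed for
  all times, and a limit of shadowing points would lie in the filled Julia set.\<close>

lemma constant_disk_in_fatou:
  assumes lam: "norm lam < lam1" and ball: "ball z0 (2 * e) \<subseteq> fatou_set UNIV (poly q)"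
    and e: "0 < e" "e \<le> 1" and t: "norm t0 < disk_const * e ^ l"
  shows "(t0, z0) \<in> fatou_set (ball 0 \<rho> \<times> UNIV) (skew_product lam f)"
proof -
  have lam_le: "norm lam \<le> 1" using lam lam1_le by simp
  define \<sigma> where "\<sigma> = disk_const * e ^ l"
  have \<sigma>: "0 < \<sigma>" using disk_const_pos e by (simp add: \<sigma>_def)
  have "\<sigma> \<le> disk_const * 1" unfolding \<sigma>_def using disk_const_pos e by (intro mult_left_mono power_le_one) auto
  also have "\<dots> \<le> \<tau>" by (simp add: disk_const_def)
  finally have \<sigma>\<rho>: "\<sigma> \<le> \<rho>" using \<tau>_le \<rho>_pos by simp
  have sub: "ball z0 e \<subseteq> ball z0 (2 * e)" "cball z0 e \<subseteq> ball z0 (2 * e)" using e by auto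
  note shadow = shadowing[OF lam _ e, folded \<sigma>_def]
  from fatou_ball_cases[OF ball] show ?thesis
  proof cases
    case 1
    have "norm (fib lam t z n) \<le> R" if tz: "norm t < \<sigma>" "z \<in> ball z0 (e / 2)" for t z n
    proof -
      have z: "norm (z - z0) < e / 2" using tz by (simp add: dist_norm norm_minus_commute)
      have bd: "norm ((poly q ^^ m) y) \<le> R" if "y \<in> ball z0 e" for y m
      proof -
        have "y \<in> filled_julia" using that 1 sub by blast
        then show ?thesis by (simp add: filled_julia_def)
      qed
      from shadow[OF tz(1) z, of n] show ?thesis
      proof (elim disjE exE bexE conjE)
        fix y assume "(poly q ^^ n) y = fib lam t z n"
          "\<forall>j\<le>n. norm ((poly q ^^ j) y) \<le> R \<and> (poly q ^^ j) y \<notin> V"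
        then show ?thesis by (metis le_refl)
      next
        fix m assume m: "m \<le> n" "fib lam t z m \<in> V"
        have "fib lam t z (m + k) \<in> V" for k
        proof (induction k)
          case (Suc k)
          then show ?case
            using norm_fiber_le(2)[OF lam tz(1)[unfolded \<sigma>_def] e, of "m + k"] by (simp add: V_inv)
        qed (use m in simp)
        from this[of "n - m"] have "fib lam t z n \<in> V" using m by simp
        then show ?thesis using V_bdd by auto
      next
        fix y m assume "y \<in> ball z0 e" "R < norm ((poly q ^^ m) y)"
        then show ?thesis using bd[of y m] by simp
      qed
    qed
    then show ?thesis
      by (intro fatou_if_bounded[OF lam_le \<sigma> \<sigma>\<rho>, of "e / 2"]) (use e t in \<open>auto simp: \<sigma>_def\<close>)
  next
    case 2
    have "\<exists>n. R < norm (fib lam t z n)" if tz: "norm t < \<sigma>" "z \<in> ball z0 (e / 2)" for t z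
    proof (rule ccontr)
      assume "\<nexists>n. R < norm (fib lam t z n)"
      then have bdd: "norm (fib lam t z n) \<le> R" for n by (auto simp: not_less)
      have z: "norm (z - z0) < e / 2" using tz by (simp add: dist_norm norm_minus_commute)
      have notV: "(poly q ^^ m) y \<notin> V" if "y \<in> ball z0 e" for y m
      proof
        assume y: "(poly q ^^ m) y \<in> V"
        have "norm ((poly q ^^ j) y) \<le> R" for j
        proof (rule ccontr)
          assume "\<not> ?thesis"
          then have "R < norm ((poly q ^^ max j m) y)"
            using orbit_stays_escaped[of j y "max j m"] by simp
          moreover have "(poly q ^^ max j m) y \<in> V" using orbit_V[OF y] by simp
          ultimately show False using V_bdd by auto
        qed
        then have "y \<in> filled_julia" by (simp add: filled_julia_def)
        then show False using 2 that sub by blast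
      qed
      \<comment> \<open>The points for different \<open>n\<close> need not agree. They lie in the
        compact \<open>cball z0 e\<close>, whose inclusion in \<open>ball z0 (2 * e)\<close> keeps
        their limit off \<open>filled_julia\<close>.\<close>
      have "\<exists>y. y \<in> cball z0 e \<and> (\<forall>j\<le>n. norm ((poly q ^^ j) y) \<le> R)" for n
      proof -
        have close: "y \<in> cball z0 e" if "norm (y - z0) < e * (1 - 1 / 2 ^ Suc n)" for y
        proof -
          have "e * (1 - 1 / 2 ^ Suc n) \<le> e * 1" using e by (intro mult_left_mono) auto
          then show ?thesis using that by (simp add: dist_norm norm_minus_commute)
        qed
        from shadow[OF tz(1) z, of n] show ?thesis
        proof (elim disjE exE bexE conjE)
          fix y assume "norm (y - z0) < e * (1 - 1 / 2 ^ Suc n)"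
            "\<forall>j\<le>n. norm ((poly q ^^ j) y) \<le> R \<and> (poly q ^^ j) y \<notin> V"
          then show ?thesis using close by blast
        next
          fix y m assume "y \<in> ball z0 e" "(poly q ^^ m) y \<in> V"
          then show ?thesis using notV[of y m] by simp
        next
          fix m assume "R < norm (fib lam t z m)"
          then show ?thesis using bdd[of m] by simp
        qed
      qed
      then obtain y where y: "\<And>n. y n \<in> cball z0 e"
        "\<And>n j. j \<le> n \<Longrightarrow> norm ((poly q ^^ j) (y n)) \<le> R" by metis
      obtain w s where w: "w \<in> cball z0 e" "strict_mono (s :: nat \<Rightarrow> nat)" "(y \<circ> s) \<longlonglongrightarrow> w"
        using compact_cball[of z0 e] y(1) unfolding compact_def by metis
      have "norm ((poly q ^^ j) w) \<le> R" for j
      proof -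
        have "(\<lambda>n. (poly q ^^ j) ((y \<circ> s) n)) \<longlonglongrightarrow> (poly q ^^ j) w"
          by (rule continuous_on_tendsto_compose[OF continuous_iterate[of UNIV] w(3)]) auto
        then show ?thesis
        proof (rule tendsto_upperbound[OF tendsto_norm])
          show "\<forall>\<^sub>F n in sequentially. norm ((poly q ^^ j) ((y \<circ> s) n)) \<le> R"
            using eventually_ge_at_top[of j]
          proof eventually_elim
            case (elim n)
            then have "j \<le> s n" using seq_suble[OF w(2), of n] by simp
            then show ?case using y(2)[of j "s n"] by simp
          qed
        qed simp
      qed
      then have "w \<in> filled_julia" by (simp add: filled_julia_def)
      then show False using 2 w(1) sub by blast
    qed
    then show ?thesis
      by (intro fatou_if_escaping[OF lam_le, of "ball 0 \<sigma> \<times> ball z0 (e / 2)"])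
         (use e t \<sigma>\<rho> in \<open>auto simp: open_Times \<sigma>_def\<close>)
  qed
qed

lemma disk_radius_lower_bound:
  assumes lam: "norm lam < lam1"
  shows "\<exists>k>0. \<forall>z\<in>fatou_set UNIV (poly q). norm z < R' \<longrightarrow>
    ereal (k * infdist z (julia_set UNIV (poly q)) powr l) \<le> disk_radius (ball 0 \<rho>) (skew_product lam f) R' z"
proof -
  let ?J = "julia_set UNIV (poly q)"
  have disk: "ereal (disk_const * e ^ l / 2) \<le> disk_radius (ball 0 \<rho>) (skew_product lam f) R' z"
    if "ball z (2 * e) \<subseteq> fatou_set UNIV (poly q)" "0 < e" "e \<le> 1" "norm z < R'" for z e
    by (rule disk_radius_geI) (use that disk_const_pos \<rho>_pos constant_disk_in_fatou[OF lam that(1-3)] in auto)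
  show ?thesis
  proof (cases "?J = {}")
    \<comment> \<open>The distance \<open>infdist\<close> to the empty set is 0, so only
      nonnegativity of the disk radius is claimed.\<close>
    case True
    then have "ball z (2 * 1) \<subseteq> fatou_set UNIV (poly q)" for z
      by (auto simp: julia_set_def)
    then have "ereal 0 \<le> disk_radius (ball 0 \<rho>) (skew_product lam f) R' z" if "norm z < R'" for z
      using disk[of z 1] that disk_const_pos by (auto intro: order_trans[of _ "ereal (disk_const / 2)"])
    then show ?thesis using True by (intro exI[of _ 1]) (auto simp: infdist_def)
  next
    case False
    then obtain w where w: "w \<in> ?J" by blast
    \<comment> \<open>\<open>C\<close> bounds the distance \<open>\<delta>\<close> of
      \<open>z\<close> to the Julia set, so \<open>\<delta> / (2 * C)\<close> is at most
      \<open>min 1 (\<delta> / 2)\<close>. This replaces the capped radius \<open>e\<close> by a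
      multiple of \<open>\<delta>\<close>.\<close>
    define C where "C = 1 + norm w + \<bar>R'\<bar>"
    have C: "1 \<le> C" by (simp add: C_def)
    define k where "k = disk_const / 2 / (2 * C) ^ l"
    have "ereal (k * infdist z ?J powr l) \<le> disk_radius (ball 0 \<rho>) (skew_product lam f) R' z"
      if z: "z \<in> fatou_set UNIV (poly q)" "norm z < R'" for z
    proof -
      define \<delta> where "\<delta> = infdist z ?J"
      have "closed ?J"
        unfolding julia_set_def by (intro closed_Diff open_fatou_set) simp
      then have \<delta>: "0 < \<delta>"
        using z(1) False infdist_pos_not_in_closed[of ?J z] by (simp add: \<delta>_def julia_set_def)
      have "\<delta> \<le> dist z w" unfolding \<delta>_def using w by (rule infdist_le)
      also have "\<dots> \<le> norm z + norm w" by (simp add: dist_norm norm_triangle_ineq4)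
      also have "\<dots> \<le> C" using z(2) by (simp add: C_def)
      finally have \<delta>C: "\<delta> \<le> C" .
      define e where "e = min 1 (\<delta> / 2)"
      have e: "0 < e" "e \<le> 1" using \<delta> by (auto simp: e_def)
      have "ball z (2 * e) \<subseteq> fatou_set UNIV (poly q)"
        using ball_infdist_julia_subset[of z "poly q"] subset_ball[of "2 * e" \<delta> z]
        by (auto simp: \<delta>_def e_def)
      note 1 = disk[OF this e z(2)]
      have "\<delta> / (2 * C) \<le> 1" "\<delta> / (2 * C) \<le> \<delta> / 2"
        using \<delta>C C \<delta> by (auto simp: field_simps)
      then have "(\<delta> / (2 * C)) ^ l \<le> e ^ l"
        using \<delta> C by (intro power_mono) (auto simp: e_def)
      then have "disk_const / 2 * (\<delta> / (2 * C)) ^ l \<le> disk_const / 2 * e ^ l"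
        using disk_const_pos by (intro mult_left_mono) auto
      then have "k * \<delta> powr l \<le> disk_const * e ^ l / 2"
        using \<delta> by (simp add: k_def powr_realpow power_divide)
      then have "ereal (k * \<delta> powr l) \<le> ereal (disk_const * e ^ l / 2)" by simp
      from order_trans[OF this 1] show ?thesis by (simp add: \<delta>_def)
    qed
    moreover have "0 < k" using disk_const_pos C by (simp add: k_def)
    ultimately show ?thesis by blast
  qed
qed

end

text \<open>\<open>R\<close> enters the dynamical constants, while \<open>R'\<close> only bounds the
  points and disks considered; hence \<open>\<epsilon>\<close> can be chosen before
  \<open>R'\<close>.\<close>

lemma fiber_family_disk_radius:
  assumes \<rho>: "0 < \<rho>" and a: "\<And>i. i \<le> d \<Longrightarrow> a i holomorphic_on ball 0 \<rho>"
    and q: "fiber_map d a 0 = poly q" "2 \<le> degree q"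
    and R: "0 < R" "\<And>t z. \<lbrakk>norm t < \<rho>; R < norm z\<rbrakk> \<Longrightarrow> 2 * norm z \<le> norm (fiber_map d a t z)"
  shows "\<exists>\<epsilon>>0. \<forall>R' lam. norm lam < \<epsilon> \<longrightarrow> (\<exists>k>0. \<forall>z\<in>fatou_set UNIV (poly q). norm z < R' \<longrightarrow>
    ereal (k * infdist z (julia_set UNIV (poly q)) powr real (degree q ^ (degree q - 1)))
      \<le> disk_radius (ball 0 \<rho>) (skew_product lam (fiber_map d a)) R' z)"
proof -
  obtain B where B: "0 < B" "\<And>t z. \<lbrakk>norm t \<le> \<rho> / 2; norm z \<le> R + 1\<rbrakk> \<Longrightarrow>
    norm (fiber_map d a t z - fiber_map d a 0 z) \<le> B * norm t"
    using fiber_map_perturbation[of \<rho> d a "R + 1"] \<rho> a R(1) by auto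
  interpret skew_family q R "fiber_map d a" \<rho> B
    using assms B R(2)[of 0] by unfold_locales auto
  show ?thesis
  proof (rule trap_exists)
    fix V \<tau>
    assume V: "open V" "V \<subseteq> cball 0 R" "\<forall>c\<in>crit. \<forall>n>0. (poly q ^^ n) c = c \<longrightarrow> c \<in> V"
      "0 < \<tau>" "\<tau> \<le> \<rho> / 2" "\<And>s w. \<lbrakk>norm s < \<tau>; w \<in> V\<rbrakk> \<Longrightarrow> fiber_map d a s w \<in> V"
    obtain \<Theta> where \<Theta>: "0 < \<Theta>" "\<Theta> \<le> 1"
      "\<forall>z m e. 0 < e \<and> e \<le> 1 \<and> (\<forall>j\<le>m. norm ((poly q ^^ j) z) \<le> R \<and> (poly q ^^ j) z \<notin> V) \<longrightarrow>
        ball ((poly q ^^ Suc m) z) (\<Theta> ^ Suc m * e ^ l) \<subseteq> (poly q ^^ Suc m) ` ball z e"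
      using ball_subset_image[OF V(1,3), folded l_def] by (elim exE conjE)
    interpret holomorphic_family q R "fiber_map d a" \<rho> B V \<tau> \<Theta> d a
      by unfold_locales (use V \<Theta> a in \<open>simp_all add: subset_iff del: funpow.simps\<close>)
    show ?thesis
      using lam1_pos disk_radius_lower_bound unfolding l_def by blast
  qed
qed

theorem theorem4p3:
  fixes p :: "complex \<Rightarrow> complex"
  shows "\<exists>l::real. 0 < l \<and>
    (\<forall>(d::nat) (\<rho>::real) (\<Delta>::complex set) (a::nat \<Rightarrow> complex \<Rightarrow> complex) (f::complex \<Rightarrow> complex \<Rightarrow> complex).
       2 \<le> d \<and> 0 < \<rho> \<and> \<Delta> = ball 0 \<rho> \<and>
       (\<forall>i\<le>d. a i holomorphic_on \<Delta>) \<and> a d 0 \<noteq> 0 \<and>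
       f = fiber_map d a \<and> p = f 0
       \<longrightarrow>
       (\<exists>lam1::real. 0 < lam1 \<and>
          (\<forall>R::real. 0 < R \<and> (\<forall>t\<in>\<Delta>. \<forall>z. R < norm z \<longrightarrow> 2 * norm z \<le> norm (f t z)) \<longrightarrow>
             (\<forall>lam::complex. 0 < norm lam \<and> norm lam < 1 \<and> norm lam < lam1 \<longrightarrow>
                (\<exists>k::real. 0 < k \<and>
                   (\<forall>z \<in> fatou_set UNIV p. norm z < R \<longrightarrow>
                      ereal (k * infdist z (julia_set UNIV p) powr l)
                        \<le> disk_radius \<Delta> (skew_product lam f) R z))))))"
proof -
  \<comment> \<open>\<open>q\<close> is chosen from \<open>p\<close> alone, before \<open>d\<close>,
    \<open>\<rho>\<close> and \<open>a\<close> are given, so that \<open>l\<close> depends only on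
    \<open>p\<close>. If \<open>p\<close> is not a polynomial, \<open>q\<close> is arbitrary and the
    claim is vacuous.\<close>
  define q where "q = (SOME q. p = poly q)"
  define l where "l = real (degree q ^ (degree q - 1))"
  \<comment> \<open>In degree 0 the truncated subtraction leads to \<open>0 ^ 0 = 1\<close>.\<close>
  have "0 < l" by (cases "degree q = 0") (auto simp: l_def)
  moreover have "\<exists>lam1::real. 0 < lam1 \<and>
      (\<forall>R::real. 0 < R \<and> (\<forall>t\<in>ball 0 \<rho>. \<forall>z. R < norm z \<longrightarrow> 2 * norm z \<le> norm (fiber_map d a t z)) \<longrightarrow>
         (\<forall>lam::complex. 0 < norm lam \<and> norm lam < 1 \<and> norm lam < lam1 \<longrightarrow>
            (\<exists>k::real. 0 < k \<and>
               (\<forall>z \<in> fatou_set UNIV p. norm z < R \<longrightarrow>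
                  ereal (k * infdist z (julia_set UNIV p) powr l)
                    \<le> disk_radius (ball 0 \<rho>) (skew_product lam (fiber_map d a)) R z))))"
    (is "\<exists>lam1. 0 < lam1 \<and> (\<forall>R. ?escape R \<longrightarrow> ?concl lam1 R)")
    if d: "2 \<le> d" and \<rho>: "0 < \<rho>" and a: "\<forall>i\<le>d. a i holomorphic_on ball 0 \<rho>" "a d 0 \<noteq> 0"
      and p: "p = fiber_map d a 0" for d :: nat and \<rho> :: real and a
  proof (cases "\<exists>R. ?escape R")
    case False
    then show ?thesis by (intro exI[of _ "1::real"] conjI zero_less_one) blast
  next
    case True
    \<comment> \<open>\<open>lam1\<close> must be found before \<open>R\<close> is given. One escape
      radius \<open>R0\<close> fixes all dynamical constants, and \<open>R\<close> is used only as
      the bound \<open>R'\<close>.\<close>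
    then obtain R0 where R0: "?escape R0" ..
    obtain q' where q': "fiber_map d a 0 = poly q'" "degree q' = d"
      using fiber_map_eq_poly a(2) by blast
    have pq: "p = poly q"
      unfolding q_def by (rule someI[of _ q']) (simp add: p q')
    then have "poly q = poly q'" using p q'(1) by simp
    then have deg: "degree q = d" using q'(2) by (simp add: poly_eq_poly_eq_iff)
    have "\<exists>\<epsilon>>0. \<forall>R' lam. norm lam < \<epsilon> \<longrightarrow> (\<exists>k>0. \<forall>z\<in>fatou_set UNIV (poly q). norm z < R' \<longrightarrow>
        ereal (k * infdist z (julia_set UNIV (poly q)) powr real (degree q ^ (degree q - 1)))
          \<le> disk_radius (ball 0 \<rho>) (skew_product lam (fiber_map d a)) R' z)"
      by (rule fiber_family_disk_radius[of \<rho> d a q R0]) (use \<rho> a R0 pq p deg d in auto)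
    then show ?thesis unfolding pq l_def by blast
  qed
  ultimately show ?thesis by (intro exI[of _ l]) blast
qed

end
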